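(* Let $g\ge0$, $m\ge1$, and let $\hat\omega\colon\widetilde{\mathcal{SD}}_{g,m}\to\mathcal{SD}_{g,m}$ and $\omega\colon\widetilde{\mathcal{SD}}_g^m\to\mathcal{SD}_g^m$ be the chain maps forgetting the enumeration of the leaves, respectively of the non-admissible boundary cycles (punctures). There are homomorphisms $$tr\colon H_*(\mathcal{SD}_{g,m};\mathbb Z)\to H_*(\widetilde{\mathcal{SD}}_{g,m};\mathbb Z)\quad\text{and}\quad tr\colon H_*(\mathcal{SD}_g^m;\mathbb Z)\to H_*(\widetilde{\mathcal{SD}}_g^m;\mathbb Z)$$ such that $\hat\omega_*\circ tr$, respectively $\omega_*\circ tr$, is multiplication by $m!$.
   Context: Write $[n]=\{0,\dots,n\}$. Permutations are composed as maps; fixed points count as cycles of length one; $(0\,1\cdots n)$ sends $i$ to $i+1$ modulo $n+1$. A (combinatorial) $1$-Sullivan diagram of degree $n\ge0$ comes in four versions. (1) Unparametrized unenumerated: a pair $\Sigma=(\lambda,\{S_1,\dots,S_k\})$, $k\ge1$, with $\lambda\in\mathrm{Symm}([n])$ (fat structure) and ghost surfaces $S_i=(g_i,m_i,A_i)$, $g_i,m_i\in\mathbb Z_{\ge0}$, where the $A_i$ are non-empty and form a partition of the set of cycles of $\lambda$, such that $S_i=(0,0,\{(r)\})$ with $(r)$ a cycle of length one implies $r=0$. Put $\rho=\lambda^{-1}\circ(0\,1\cdots n)$ and $m=\#\{\text{cycles of }\rho\}+\sum_i m_i$ (the number of punctures). (2) Unparametrized enumerated: as in (1) together with an injection $\beta_1\colon\{\text{cycles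 of }\rho\}\to\{1,\dots,m\}$ and a map $\beta_2\colon\{1,\dots,m\}\setminus\mathrm{im}\,\beta_1\to\{S_1,\dots,S_k\}$ with $|\beta_2^{-1}(S_i)|=m_i$. (3) Parametrized enumerated with leaves $L=\{l_1,\dots,l_m\}$, $m\ge1$: as in (1), but $\lambda\in\mathrm{Symm}([n]\sqcup L)$, $\rho=\lambda^{-1}\circ(0\,1\cdots n)\in\mathrm{Symm}([n]\sqcup L)$, all $m_i=0$, each $A_i$ contains a cycle with an element of $[n]$, and each cycle of $\rho$ contains exactly one element of $L$. (4) Parametrized unenumerated: an orbit of diagrams as in (3) under the action of $\mathrm{Symm}(L)$ by conjugation (renaming the leaves). In all cases the genus $g$ is determined by $2-2g-(m+1)=\sum_i(2-2g_i-m_i-|A_i|)-(n+1)$. Faces. For $\Sigma$ of degree $n\ge1$ and $0\le i\le n$ let $a=\rho(i)=\lambda^{-1}(i+1)$ (with $n+1$ read as $0$) and $\underline\lambda=\lambda\circ(i\ a)$ (with $(i\ i)=\mathrm{id}$). The fat structure of $d_i\Sigma$ is $D_i(\underline\lambda)$, where $D_i$ deletes $i$ from its cycle and then renumbers $j\mapsto j-1$ for $j\in[n]$, $j>i$; its non-degenerate boundary is $D_i(\rho)$. Cycles of $\underline\lambda$ are identified with those of $D_i(\underline\lambda)$. Ghost surfaces: if $a=i$ (possible only in the unparametrized versions), the ghost surface containing the cycle of $i$ gets one more puncture ($m_j\mapsto m_j+1$; in version (2) the label of the cycle $(i)$ of $\rho$ is assigned to this ghost surface by $\beta_2$). If $a\neq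 i$ and $i,a$ lie in different cycles of $\lambda$, these cycles merge; if they belong to different ghost surfaces, these two are replaced by one, adding genera and numbers of punctures and uniting the (merged) sets of cycles; if they belong to the same ghost surface, its genus increases by one. If $a\ne i$ lie in the same cycle of $\lambda$, this cycle splits into two cycles, both kept in the same ghost surface. Everything else (including enumerations) is carried along unchanged. $\widetilde{\mathcal{SD}}_{g,m}$ (version (3)), $\mathcal{SD}_{g,m}$ (version (4)), $\widetilde{\mathcal{SD}}_g^m$ (version (2)) and $\mathcal{SD}_g^m$ (version (1)) are the chain complexes that are free abelian in degree $n$ on the diagrams of that version of degree $n$, with genus $g$ and the given $m$, with differential $d=\sum_{i=0}^n(-1)^id_i$. The map $\hat\omega$ sends a diagram of version (3) to its $\mathrm{Symm}(L)$-orbit; $\omega$ forgets $\beta_1,\beta_2$. *)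

theory Defs
  imports
    "HOL-Algebra.Free_Abelian_Groups"
    "HOL-Combinatorics.Permutations"
    "HOL-Combinatorics.Orbits"
    "HOL-Library.Disjoint_Sets"
begin

section \<open>Homology of a graded set with face maps\<close>

text \<open>
  \<open>X n\<close> is the set of generators in degree \<open>n\<close> and \<open>f n i\<close> is the \<open>i\<close>-th face map on
  generators of degree \<open>n\<close>. All complexes vanish in negative degrees, so the differential is
  zero in degree 0.
\<close>

definition face_boundary :: "(nat \<Rightarrow> nat \<Rightarrow> 'a \<Rightarrow> 'a) \<Rightarrow> nat \<Rightarrow> ('a \<Rightarrow>\<^sub>0 int) \<Rightarrow> ('a \<Rightarrow>\<^sub>0 int)" where
  "face_boundary f n =
     (if n = 0 then (\<lambda>c. 0)
      else frag_extend (\<lambda>x. \<Sum>i\<le>n. frag_cmul ((-1) ^ i) (frag_of (f n i x))))"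

definition face_chain_group :: "(nat \<Rightarrow> 'a set) \<Rightarrow> nat \<Rightarrow> ('a \<Rightarrow>\<^sub>0 int) monoid" where
  "face_chain_group X n = free_Abelian_group (X n)"

definition face_cycles ::
    "(nat \<Rightarrow> 'a set) \<Rightarrow> (nat \<Rightarrow> nat \<Rightarrow> 'a \<Rightarrow> 'a) \<Rightarrow> nat \<Rightarrow> ('a \<Rightarrow>\<^sub>0 int) set" where
  "face_cycles X f n = {c \<in> carrier (face_chain_group X n). face_boundary f n c = 0}"

definition face_boundaries ::
    "(nat \<Rightarrow> 'a set) \<Rightarrow> (nat \<Rightarrow> nat \<Rightarrow> 'a \<Rightarrow> 'a) \<Rightarrow> nat \<Rightarrow> ('a \<Rightarrow>\<^sub>0 int) set" where
  "face_boundaries X f n = face_boundary f (Suc n) ` carrier (face_chain_group X (Suc n))"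

definition face_homology ::
    "(nat \<Rightarrow> 'a set) \<Rightarrow> (nat \<Rightarrow> nat \<Rightarrow> 'a \<Rightarrow> 'a) \<Rightarrow> nat \<Rightarrow> ('a \<Rightarrow>\<^sub>0 int) set monoid" where
  "face_homology X f n =
     subgroup_generated (face_chain_group X n) (face_cycles X f n) Mod face_boundaries X f n"

text \<open>
  The map in degree \<open>n\<close> homology induced by a map \<open>\<phi>\<close> of generators: the class \<open>z + B\<close> goes to
  \<open>\<phi>(z) + B'\<close>, where \<open>B'\<close> are the boundaries of the target, written here without a choice of
  representative.
\<close>

definition face_homology_map ::
    "(nat \<Rightarrow> 'b set) \<Rightarrow> (nat \<Rightarrow> nat \<Rightarrow> 'b \<Rightarrow> 'b) \<Rightarrow> ('a \<Rightarrow> 'b) \<Rightarrow> nat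
       \<Rightarrow> ('a \<Rightarrow>\<^sub>0 int) set \<Rightarrow> ('b \<Rightarrow>\<^sub>0 int) set" where
  "face_homology_map Y f \<phi> n K =
     face_boundaries Y f n <#>\<^bsub>face_chain_group Y n\<^esub> frag_extend (frag_of \<circ> \<phi>) ` K"


section \<open>Sullivan diagrams\<close>

datatype point = Pt nat | Leaf nat

definition leaves :: "nat \<Rightarrow> point set" where
  "leaves m = Leaf ` {1..m}"

text \<open>
  \<open>points n m\<close> is \<open>[n] \<squnion> {l\<^sub>1, \<dots>, l\<^sub>m}\<close>; in particular \<open>points n 0\<close> is \<open>[n]\<close>, so
  unparametrized diagrams are the case of zero leaves for all constructions on fat structures.
\<close>

definition points :: "nat \<Rightarrow> nat \<Rightarrow> point set" where
  "points n m = Pt ` {..n} \<union> leaves m"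

fun long_cycle :: "nat \<Rightarrow> point \<Rightarrow> point" where
  "long_cycle n (Pt j) = (if j \<le> n then Pt (Suc j mod Suc n) else Pt j)"
| "long_cycle n (Leaf k) = Leaf k"

text \<open>
  A cycle of a permutation is represented by its underlying set (which, for a given permutation,
  determines it). Fixed points of \<open>p\<close> in \<open>A\<close> give singletons.
\<close>

definition perm_cycles :: "(point \<Rightarrow> point) \<Rightarrow> point set \<Rightarrow> point set set" where
  "perm_cycles p A = orbit p ` A"

datatype surface =
  Surface (sgenus: nat) (spunct: nat) (scycles: "point set set")

datatype diagram =
  Diagram (fat: "point \<Rightarrow> point") (ghosts: "surface set")

definition outer :: "nat \<Rightarrow> diagram \<Rightarrow> point \<Rightarrow> point" where
  "outer n D = inv_into UNIV (fat D) \<circ> long_cycle n"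

text \<open>
  The conditions common to all versions. As the \<open>A\<^sub>i\<close> are non-empty and pairwise disjoint, the
  family of ghost surfaces is a set on which \<open>S\<^sub>i \<mapsto> A\<^sub>i\<close> is injective.
\<close>

definition sullivan_diagram :: "nat \<Rightarrow> nat \<Rightarrow> diagram \<Rightarrow> bool" where
  "sullivan_diagram n m D \<longleftrightarrow>
     fat D permutes points n m \<and>
     inj_on scycles (ghosts D) \<and>
     partition_on (perm_cycles (fat D) (points n m)) (scycles ` ghosts D) \<and>
     (\<forall>S\<in>ghosts D. \<forall>r. S = Surface 0 0 {{r}} \<longrightarrow> r = Pt 0)"

text \<open>\<open>m\<close> is the number of punctures or leaves and \<open>n\<close> the degree.\<close>

definition has_genus :: "nat \<Rightarrow> nat \<Rightarrow> nat \<Rightarrow> diagram \<Rightarrow> bool" where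
  "has_genus n m g D \<longleftrightarrow>
     2 - 2 * int g - (int m + 1) =
     (\<Sum>S\<in>ghosts D. 2 - 2 * int (sgenus S) - int (spunct S) - int (card (scycles S)))
       - (int n + 1)"

definition num_punctures :: "nat \<Rightarrow> diagram \<Rightarrow> nat" where
  "num_punctures n D = card (perm_cycles (outer n D) (points n 0)) + (\<Sum>S\<in>ghosts D. spunct S)"


subsection \<open>Generators\<close>

definition unpar_unenum :: "nat \<Rightarrow> nat \<Rightarrow> nat \<Rightarrow> diagram set" where
  "unpar_unenum g m n =
     {D. sullivan_diagram n 0 D \<and> num_punctures n D = m \<and> has_genus n m g D}"

text \<open>
  \<open>enum_cycles\<close> and \<open>enum_ghosts\<close> are \<open>\<beta>\<^sub>1\<close> and \<open>\<beta>\<^sub>2\<close>, required to be \<open>undefined\<close> outside their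
  domains so that equality of diagrams is the intended one.
\<close>

datatype enum_diagram =
  Enum_Diagram (underlying: diagram) (enum_cycles: "point set \<Rightarrow> nat") (enum_ghosts: "nat \<Rightarrow> surface")

definition unpar_enum :: "nat \<Rightarrow> nat \<Rightarrow> nat \<Rightarrow> enum_diagram set" where
  "unpar_enum g m n =
     {E. let D = underlying E; C = perm_cycles (outer n D) (points n 0);
             L = {1..m} - enum_cycles E ` C
         in D \<in> unpar_unenum g m n \<and>
            enum_cycles E \<in> C \<rightarrow>\<^sub>E {1..m} \<and> inj_on (enum_cycles E) C \<and>
            enum_ghosts E \<in> L \<rightarrow>\<^sub>E ghosts D \<and>
            (\<forall>S\<in>ghosts D. card {l \<in> L. enum_ghosts E l = S} = spunct S)}"

definition par_enum :: "nat \<Rightarrow> nat \<Rightarrow> nat \<Rightarrow> diagram set" where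
  "par_enum g m n =
     {D. sullivan_diagram n m D \<and>
         (\<forall>S\<in>ghosts D. spunct S = 0 \<and> (\<exists>C\<in>scycles S. C \<inter> Pt ` {..n} \<noteq> {})) \<and>
         (\<forall>C\<in>perm_cycles (outer n D) (points n m). \<exists>!l. l \<in> C \<inter> leaves m) \<and>
         has_genus n m g D}"

definition rename_surface :: "(point \<Rightarrow> point) \<Rightarrow> surface \<Rightarrow> surface" where
  "rename_surface \<tau> S = Surface (sgenus S) (spunct S) ((`) \<tau> ` scycles S)"

definition rename_leaves :: "(point \<Rightarrow> point) \<Rightarrow> diagram \<Rightarrow> diagram" where
  "rename_leaves \<tau> D = Diagram (\<tau> \<circ> fat D \<circ> inv_into UNIV \<tau>) (rename_surface \<tau> ` ghosts D)"

definition leaf_orbit :: "nat \<Rightarrow> diagram \<Rightarrow> diagram set" where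
  "leaf_orbit m D = {rename_leaves \<tau> D | \<tau>. \<tau> permutes leaves m}"

definition par_unenum :: "nat \<Rightarrow> nat \<Rightarrow> nat \<Rightarrow> diagram set set" where
  "par_unenum g m n = leaf_orbit m ` par_enum g m n"


subsection \<open>Faces\<close>

text \<open>
  Deleting the point \<open>i\<close> and renumbering, for points, for cycles (as sets), for permutations
  (\<open>D\<^sub>i\<close>) and for ghost surfaces.
\<close>

fun renumber :: "nat \<Rightarrow> point \<Rightarrow> point" where
  "renumber i (Pt j) = Pt (if i < j then j - 1 else j)"
| "renumber i (Leaf k) = Leaf k"

fun skip :: "nat \<Rightarrow> point \<Rightarrow> point" where
  "skip i (Pt j) = Pt (if j < i then j else Suc j)"
| "skip i (Leaf k) = Leaf k"

definition delete_cycle :: "nat \<Rightarrow> point set \<Rightarrow> point set" where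
  "delete_cycle i C = renumber i ` (C - {Pt i})"

definition delete_perm :: "nat \<Rightarrow> (point \<Rightarrow> point) \<Rightarrow> point \<Rightarrow> point" where
  "delete_perm i p x =
     renumber i (if p (skip i x) = Pt i then p (Pt i) else p (skip i x))"

definition delete_surface :: "nat \<Rightarrow> surface \<Rightarrow> surface" where
  "delete_surface i S = Surface (sgenus S) (spunct S) (delete_cycle i ` scycles S)"

definition surface_of :: "diagram \<Rightarrow> point \<Rightarrow> surface" where
  "surface_of D x = (THE S. S \<in> ghosts D \<and> orbit (fat D) x \<in> scycles S)"

definition face_fat :: "nat \<Rightarrow> nat \<Rightarrow> diagram \<Rightarrow> point \<Rightarrow> point" where
  "face_fat n i D = fat D \<circ> transpose (Pt i) (outer n D (Pt i))"

text \<open>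
  The ghost surface that a ghost surface \<open>S\<close> of \<open>D\<close> becomes in the \<open>i\<close>-th face, before deleting
  the point \<open>i\<close>: its cycles are cycles of \<open>\<lambda> \<circ> (i a)\<close>.
\<close>

definition face_surface :: "nat \<Rightarrow> nat \<Rightarrow> diagram \<Rightarrow> surface \<Rightarrow> surface" where
  "face_surface n i D S =
     (let x = Pt i; a = outer n D x; q = face_fat n i D;
          Cx = orbit (fat D) x; Ca = orbit (fat D) a;
          Sx = surface_of D x; Sa = surface_of D a
      in if a = x then
           (if S = Sx then Surface (sgenus S) (Suc (spunct S)) (scycles S) else S)
         else if Cx \<noteq> Ca \<and> Sx \<noteq> Sa then
           (if S \<in> {Sx, Sa}
            then Surface (sgenus Sx + sgenus Sa) (spunct Sx + spunct Sa)
                   (insert (orbit q x) (scycles Sx \<union> scycles Sa - {Cx, Ca}))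
            else S)
         else if Cx \<noteq> Ca then
           (if S = Sx
            then Surface (Suc (sgenus S)) (spunct S)
                   (insert (orbit q x) (scycles S - {Cx, Ca}))
            else S)
         else
           (if S = Sx
            then Surface (sgenus S) (spunct S)
                   ({orbit q x, orbit q a} \<union> (scycles S - {Cx}))
            else S))"

definition face_ghost :: "nat \<Rightarrow> nat \<Rightarrow> diagram \<Rightarrow> surface \<Rightarrow> surface" where
  "face_ghost n i D = delete_surface i \<circ> face_surface n i D"

definition face :: "nat \<Rightarrow> nat \<Rightarrow> diagram \<Rightarrow> diagram" where
  "face n i D = Diagram (delete_perm i (face_fat n i D)) (face_ghost n i D ` ghosts D)"

text \<open>
  Faces of enumerated diagrams. The cycles of the new outer permutation \<open>D\<^sub>i(\<rho>)\<close> are in bijection,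
  via deletion of \<open>i\<close>, with the cycles of \<open>\<rho>\<close> other than \<open>(i)\<close>, and keep their labels; the labels
  of punctures follow their ghost surfaces, and the label of a cycle \<open>(i)\<close> of \<open>\<rho>\<close> goes to the
  ghost surface containing the cycle of \<open>i\<close>.
\<close>

definition face_enum :: "nat \<Rightarrow> nat \<Rightarrow> nat \<Rightarrow> enum_diagram \<Rightarrow> enum_diagram" where
  "face_enum m n i E =
     (let D = underlying E; \<rho> = outer n D; h = face_ghost n i D;
          C = perm_cycles \<rho> (points n 0);
          C' = perm_cycles (delete_perm i \<rho>) (points (n - 1) 0);
          b1 = restrict (enum_cycles E \<circ> inv_into (C - {{Pt i}}) (delete_cycle i)) C';
          b2 = restrict
                 (\<lambda>l. if \<rho> (Pt i) = Pt i \<and> l = enum_cycles E {Pt i}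
                      then h (surface_of D (Pt i)) else h (enum_ghosts E l))
                 ({1..m} - b1 ` C')
      in Enum_Diagram (face n i D) b1 b2)"

text \<open>The faces of the diagrams in an orbit form an orbit.\<close>

definition face_orbit :: "nat \<Rightarrow> nat \<Rightarrow> diagram set \<Rightarrow> diagram set" where
  "face_orbit n i \<Theta> = face n i ` \<Theta>"


subsection \<open>Homology of the four complexes\<close>

definition H_par_enum :: "nat \<Rightarrow> nat \<Rightarrow> nat \<Rightarrow> (diagram \<Rightarrow>\<^sub>0 int) set monoid" where
  "H_par_enum g m = face_homology (par_enum g m) face"

definition H_par_unenum :: "nat \<Rightarrow> nat \<Rightarrow> nat \<Rightarrow> (diagram set \<Rightarrow>\<^sub>0 int) set monoid" where
  "H_par_unenum g m = face_homology (par_unenum g m) face_orbit"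

definition H_unpar_enum :: "nat \<Rightarrow> nat \<Rightarrow> nat \<Rightarrow> (enum_diagram \<Rightarrow>\<^sub>0 int) set monoid" where
  "H_unpar_enum g m = face_homology (unpar_enum g m) (face_enum m)"

definition H_unpar_unenum :: "nat \<Rightarrow> nat \<Rightarrow> nat \<Rightarrow> (diagram \<Rightarrow>\<^sub>0 int) set monoid" where
  "H_unpar_unenum g m = face_homology (unpar_unenum g m) face"

text \<open>The maps induced by passing to the orbit of leaf enumerations, and by forgetting the
  enumeration of the punctures.\<close>

definition forget_leaves_homology ::
    "nat \<Rightarrow> nat \<Rightarrow> nat \<Rightarrow> (diagram \<Rightarrow>\<^sub>0 int) set \<Rightarrow> (diagram set \<Rightarrow>\<^sub>0 int) set" where
  "forget_leaves_homology g m = face_homology_map (par_unenum g m) face_orbit (leaf_orbit m)"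

definition forget_punctures_homology ::
    "nat \<Rightarrow> nat \<Rightarrow> nat \<Rightarrow> (enum_diagram \<Rightarrow>\<^sub>0 int) set \<Rightarrow> (diagram \<Rightarrow>\<^sub>0 int) set" where
  "forget_punctures_homology g m = face_homology_map (unpar_unenum g m) face underlying"

end

theory Submission
  imports Defs
begin

text \<open>
  Both transfers come from an action of the symmetric group on \<open>m\<close> letters: on parametrized
  diagrams by renaming the leaves, on unparametrized enumerated diagrams by permuting the labels
  of the punctures. In each case the forgetful map identifies precisely the elements of an orbit,
  every unenumerated diagram has an enumerated lift, and the face maps are equivariant. The
  transfer sends a diagram to the sum of \<open>\<sigma>E\<close> over all \<open>\<sigma>\<close>, where \<open>E\<close> is any lift; all \<open>m!\<close>
  permutations are summed, so the summands repeat when \<open>E\<close> has a stabilizer, and forgetting the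
  enumeration gives \<open>m!\<close> times the diagram. The sum does not depend on \<open>E\<close> because the action is
  transitive on lifts. It therefore commutes with the face maps: the face of a lift is a lift of
  the face, and equivariance turns its orbit sum into the face of the orbit sum. This general
  statement is \<open>homology_transfer_of_symmetric_group_action\<close>.

  For leaves, orbits are the unenumerated diagrams by definition, and the work is in the
  equivariance of the face maps, \<open>face_rename_leaves\<close>. For punctures, equivariance is a matter of
  bookkeeping, while three facts need an argument. An enumeration amounts to distributing the
  labels over cycles of the outer permutation and ghost surfaces, with the number of labels at
  each place prescribed by the diagram; any two such distributions differ by a permutation
  (\<open>puncture_enumerations_transitive\<close>), and there is one because these numbers add up to \<open>m\<close>
  (\<open>puncture_enumeration_exists\<close>). Finally the face of an enumeration is an enumeration of the face
  (\<open>face_enum_in_puncture_enumerations\<close>). That rests on two properties of the face construction: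
  the outer permutation of a face is the outer permutation with a point deleted (\<open>outer_face\<close>), and
  the only ghost surfaces that become equal in a face are the two that are merged, whose numbers of
  punctures add up (\<open>face_ghost_eq_imp\<close>, \<open>spunct_face_ghost\<close>).
\<close>

section \<open>Homology classes and linear maps of face complexes\<close>

text \<open>
  The elements of homology are cosets of the group of boundaries. Writing them as translates of the
  boundaries by a chain reduces all statements about homology to statements about chains.
\<close>

definition homology_class ::
    "(nat \<Rightarrow> 'a set) \<Rightarrow> (nat \<Rightarrow> nat \<Rightarrow> 'a \<Rightarrow> 'a) \<Rightarrow> nat \<Rightarrow> ('a \<Rightarrow>\<^sub>0 int) \<Rightarrow> ('a \<Rightarrow>\<^sub>0 int) set" where
  "homology_class X f n z = (\<lambda>b. b + z) ` face_boundaries X f n"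

lemma frag_cmul_diff_right: "frag_cmul k (a - b) = frag_cmul k a - frag_cmul k b"
  by (rule poly_mapping_eqI) (simp add: lookup_minus right_diff_distrib)

lemma face_boundary_add: "face_boundary f n (a + b) = face_boundary f n a + face_boundary f n b"
  by (simp add: face_boundary_def frag_extend_add)

lemma face_boundary_uminus: "face_boundary f n (- a) = - face_boundary f n a"
  by (simp add: face_boundary_def frag_extend_minus)

lemma face_boundary_zero: "face_boundary f n 0 = 0"
  by (simp add: face_boundary_def)

lemma zero_in_face_boundaries: "0 \<in> face_boundaries X f n"
  unfolding face_boundaries_def face_chain_group_def
  by (rule image_eqI[where x = 0]) (simp_all add: face_boundary_zero)

lemma face_boundaries_add:
  assumes "a \<in> face_boundaries X f n" "b \<in> face_boundaries X f n"
  shows "a + b \<in> face_boundaries X f n"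
proof -
  obtain u v where "a = face_boundary f (Suc n) u" "b = face_boundary f (Suc n) v"
    "Poly_Mapping.keys u \<subseteq> X (Suc n)" "Poly_Mapping.keys v \<subseteq> X (Suc n)"
    using assms unfolding face_boundaries_def face_chain_group_def by auto
  then show ?thesis
    unfolding face_boundaries_def face_chain_group_def
    by (intro image_eqI[where x = "u + v"]) (use keys_add[of u v] in \<open>auto simp: face_boundary_add\<close>)
qed

lemma subgroup_face_cycles: "subgroup (face_cycles X f n) (face_chain_group X n)"
proof
  fix x y assume "x \<in> face_cycles X f n" "y \<in> face_cycles X f n"
  then show "x \<otimes>\<^bsub>face_chain_group X n\<^esub> y \<in> face_cycles X f n"
    using keys_add by (fastforce simp: face_cycles_def face_chain_group_def face_boundary_add)
qed (auto simp: face_cycles_def face_chain_group_def face_boundary_zero face_boundary_uminus)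

lemma carrier_face_homology:
  "carrier (face_homology X f n) = homology_class X f n ` face_cycles X f n"
proof -
  interpret group "face_chain_group X n" by (simp add: face_chain_group_def)
  have "carrier (subgroup_generated (face_chain_group X n) (face_cycles X f n)) = face_cycles X f n"
    by (simp add: subgroup.carrier_subgroup_generated_subgroup subgroup_face_cycles)
  then show ?thesis
    by (auto simp: face_homology_def carrier_FactGroup homology_class_def r_coset_def
        face_chain_group_def image_iff)
qed

lemma mult_face_homology:
  "homology_class X f n z \<otimes>\<^bsub>face_homology X f n\<^esub> homology_class X f n w
    = homology_class X f n (z + w)"
proof -
  have "{a + b |a b. a \<in> homology_class X f n z \<and> b \<in> homology_class X f n w}
      = homology_class X f n (z + w)" (is "?L = ?R")
  proof
    show "?L \<subseteq> ?R"
    proof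
      fix x assume "x \<in> ?L"
      then obtain a b where "x = (a + z) + (b + w)" and ab: "a \<in> face_boundaries X f n"
          "b \<in> face_boundaries X f n"
        unfolding homology_class_def by blast
      then have "x = (a + b) + (z + w)" by (simp add: algebra_simps)
      with ab show "x \<in> ?R" unfolding homology_class_def using face_boundaries_add by blast
    qed
    show "?R \<subseteq> ?L"
    proof
      fix x assume "x \<in> ?R"
      then obtain a where "x = (a + z) + (0 + w)" "a \<in> face_boundaries X f n"
        by (auto simp: homology_class_def algebra_simps)
      then show "x \<in> ?L" unfolding homology_class_def using zero_in_face_boundaries by blast
    qed
  qed
  then show ?thesis
    by (simp add: face_homology_def set_mult_def face_chain_group_def) blast
qed

lemma pow_face_homology:
  fixes k :: nat
  shows "homology_class X f n z [^]\<^bsub>face_homology X f n\<^esub> k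
    = homology_class X f n (frag_cmul (int k) z)"
proof (induction k)
  case 0
  show ?case by (simp add: nat_pow_def face_homology_def homology_class_def)
next
  case (Suc k)
  then show ?case
    by (simp add: nat_pow_def mult_face_homology frag_cmul_distrib add.commute)
qed

text \<open>
  The analogue of the map induced by a map of generators for a generator map with values in chains,
  as needed for a transfer, whose value on a generator is a sum over its lifts.
\<close>

definition linear_homology_map ::
    "(nat \<Rightarrow> 'b set) \<Rightarrow> (nat \<Rightarrow> nat \<Rightarrow> 'b \<Rightarrow> 'b) \<Rightarrow> ('a \<Rightarrow> 'b \<Rightarrow>\<^sub>0 int) \<Rightarrow> nat
       \<Rightarrow> ('a \<Rightarrow>\<^sub>0 int) set \<Rightarrow> ('b \<Rightarrow>\<^sub>0 int) set" where
  "linear_homology_map Y F t n K =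
     face_boundaries Y F n <#>\<^bsub>face_chain_group Y n\<^esub> frag_extend t ` K"

lemma face_homology_map_eq:
  "face_homology_map Y F \<phi> n = linear_homology_map Y F (frag_of \<circ> \<phi>) n"
  by (simp add: fun_eq_iff face_homology_map_def linear_homology_map_def)

text \<open>
  Translating by boundaries of the target absorbs the images of the boundaries of the source, so
  the coset-wise formula is evaluated on any representative.
\<close>

lemma linear_homology_map_class:
  assumes "frag_extend t ` face_boundaries X f n \<subseteq> face_boundaries Y F n"
  shows "linear_homology_map Y F t n (homology_class X f n z)
    = homology_class Y F n (frag_extend t z)"
proof -
  have "{b + frag_extend t c | b c. b \<in> face_boundaries Y F n \<and> c \<in> homology_class X f n z}
      = homology_class Y F n (frag_extend t z)" (is "?L = ?R")
  proof
    show "?L \<subseteq> ?R"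
    proof
      fix x assume "x \<in> ?L"
      then obtain b c where "x = b + frag_extend t (c + z)" 
          and bc: "b \<in> face_boundaries Y F n" "c \<in> face_boundaries X f n"
        unfolding homology_class_def by blast
      then have "x = (b + frag_extend t c) + frag_extend t z"
        by (simp add: frag_extend_add algebra_simps)
      with bc show "x \<in> ?R" unfolding homology_class_def using face_boundaries_add assms by blast
    qed
    show "?R \<subseteq> ?L"
    proof
      fix x assume "x \<in> ?R"
      then obtain b where "x = b + frag_extend t (0 + z)" "b \<in> face_boundaries Y F n"
        by (auto simp: homology_class_def)
      then show "x \<in> ?L" unfolding homology_class_def using zero_in_face_boundaries by blast
    qed
  qed
  then show ?thesis
    by (simp add: linear_homology_map_def set_mult_def face_chain_group_def) blast
qed

text \<open>
  Commutation with each single face map suffices for commutation with the alternating sum. The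
  hypothesis is imposed on generators in \<open>X\<close> only, as face maps are unconstrained elsewhere.
\<close>

lemma face_boundary_frag_extend:
  assumes "\<And>x i. \<lbrakk>x \<in> X; i \<le> n\<rbrakk> \<Longrightarrow> t' (f n i x) = frag_extend (frag_of \<circ> F n i) (t x)"
    and "Poly_Mapping.keys c \<subseteq> X"
    and "n \<noteq> 0"
  shows "face_boundary F n (frag_extend t c) = frag_extend t' (face_boundary f n c)"
proof -
  have bd: "face_boundary F n a = (\<Sum>i\<le>n. frag_cmul ((-1) ^ i) (frag_extend (frag_of \<circ> F n i) a))"
    for a
    using subset_UNIV[of "Poly_Mapping.keys a"]
    by (induction a rule: frag_induction)
      (use assms(3) in \<open>simp_all add: face_boundary_def frag_extend_diff frag_cmul_diff_right
        sum_subtractf\<close>)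
  show "face_boundary F n (frag_extend t c) = frag_extend t' (face_boundary f n c)"
    using assms(2)
  proof (induction c rule: frag_induction)
    case (one x)
    then show ?case
      by (simp add: bd) (simp add: assms(3) face_boundary_def frag_extend_sum frag_extend_cmul
        assms(1) o_def)
  next
    case (diff a b)
    then show ?case
      by (simp add: frag_extend_diff diff_conv_add_uminus face_boundary_add face_boundary_uminus
          frag_extend_add frag_extend_minus del: add_uminus_conv_diff)
  qed (simp add: face_boundary_zero)
qed

text \<open>
  Only the restriction to generators of the complex matters, and commutation is required for each
  face map separately. This is stronger than commuting with the differential, but is what both the
  forgetful maps and the transfers satisfy.
\<close>

definition face_chain_map ::
    "(nat \<Rightarrow> 'a set) \<Rightarrow> (nat \<Rightarrow> nat \<Rightarrow> 'a \<Rightarrow> 'a) \<Rightarrow> (nat \<Rightarrow> 'b set) \<Rightarrow> (nat \<Rightarrow> nat \<Rightarrow> 'b \<Rightarrow> 'b)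
       \<Rightarrow> (nat \<Rightarrow> 'a \<Rightarrow> 'b \<Rightarrow>\<^sub>0 int) \<Rightarrow> bool" where
  "face_chain_map X f Y F t \<longleftrightarrow>
     (\<forall>n. \<forall>x\<in>X n. Poly_Mapping.keys (t n x) \<subseteq> Y n) \<and>
     (\<forall>n. \<forall>x\<in>X (Suc n). \<forall>i\<le>Suc n.
        frag_extend (frag_of \<circ> F (Suc n) i) (t (Suc n) x) = t n (f (Suc n) i x))"

lemma keys_frag_extend_chain_map:
  assumes "face_chain_map X f Y F t" "Poly_Mapping.keys c \<subseteq> X n"
  shows "Poly_Mapping.keys (frag_extend (t n) c) \<subseteq> Y n"
  using keys_frag_extend[of "t n" c] assms unfolding face_chain_map_def by blast

lemma face_chain_map_boundaries:
  assumes "face_chain_map X f Y F t"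
  shows "frag_extend (t n) ` face_boundaries X f n \<subseteq> face_boundaries Y F n"
proof -
  have "frag_extend (t n) (face_boundary f (Suc n) c) \<in> face_boundaries Y F n"
    if c: "Poly_Mapping.keys c \<subseteq> X (Suc n)" for c
  proof -
    have "face_boundary F (Suc n) (frag_extend (t (Suc n)) c)
      = frag_extend (t n) (face_boundary f (Suc n) c)"
      by (rule face_boundary_frag_extend[OF _ c]) (use assms in \<open>auto simp: face_chain_map_def\<close>)
    then show ?thesis
      using keys_frag_extend_chain_map[OF assms c]
      by (auto simp: face_boundaries_def face_chain_group_def intro!: image_eqI)
  qed
  then show ?thesis
    by (auto simp: face_boundaries_def face_chain_group_def)
qed

lemma face_chain_map_cycles:
  assumes "face_chain_map X f Y F t" "z \<in> face_cycles X f n"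
  shows "frag_extend (t n) z \<in> face_cycles Y F n"
proof -
  have z: "Poly_Mapping.keys z \<subseteq> X n" "face_boundary f n z = 0"
    using assms(2) by (auto simp: face_cycles_def face_chain_group_def)
  have "face_boundary F n (frag_extend (t n) z) = 0"
  proof (cases n)
    case 0
    then show ?thesis by (simp add: face_boundary_def)
  next
    case (Suc k)
    have "face_boundary F n (frag_extend (t n) z) = frag_extend (t k) (face_boundary f n z)"
      by (rule face_boundary_frag_extend[OF _ z(1)])
        (use assms Suc in \<open>auto simp: face_chain_map_def\<close>)
    then show ?thesis by (simp add: z)
  qed
  then show ?thesis
    using keys_frag_extend_chain_map[OF assms(1) z(1)]
    by (simp add: face_cycles_def face_chain_group_def)
qed

lemma linear_homology_map_hom:
  assumes "face_chain_map X f Y F t"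
  shows "linear_homology_map Y F (t n) n \<in> hom (face_homology X f n) (face_homology Y F n)"
proof (rule homI)
  note cls = linear_homology_map_class[OF face_chain_map_boundaries[OF assms]]
  fix x assume x: "x \<in> carrier (face_homology X f n)"
  then show "linear_homology_map Y F (t n) n x \<in> carrier (face_homology Y F n)"
    using face_chain_map_cycles[OF assms] by (auto simp: carrier_face_homology cls)
  fix y assume "y \<in> carrier (face_homology X f n)"
  with x show "linear_homology_map Y F (t n) n (x \<otimes>\<^bsub>face_homology X f n\<^esub> y) =
      linear_homology_map Y F (t n) n x \<otimes>\<^bsub>face_homology Y F n\<^esub> linear_homology_map Y F (t n) n y"
    by (auto simp: carrier_face_homology cls mult_face_homology frag_extend_add)
qed

section \<open>Transfers from symmetric group actions\<close>

text \<open>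
  On representatives, both maps are the chain maps themselves, so the identity on chains passes to
  homology classes.
\<close>

lemma homology_transfer_of_chain_transfer:
  assumes t: "face_chain_map X f Y F t"
    and \<phi>: "face_chain_map Y F X f (\<lambda>n. frag_of \<circ> \<phi>)"
    and comp: "\<And>n x. x \<in> X n \<Longrightarrow> frag_extend (frag_of \<circ> \<phi>) (t n x) = frag_cmul (int N) (frag_of x)"
  shows "\<exists>tr. \<forall>n. tr n \<in> hom (face_homology X f n) (face_homology Y F n) \<and>
           (\<forall>x \<in> carrier (face_homology X f n).
              face_homology_map X f \<phi> n (tr n x) = x [^]\<^bsub>face_homology X f n\<^esub> N)"
proof (intro exI allI conjI ballI)
  fix n
  show "linear_homology_map Y F (t n) n \<in> hom (face_homology X f n) (face_homology Y F n)"
    by (rule linear_homology_map_hom[OF t])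
  fix x assume "x \<in> carrier (face_homology X f n)"
  then obtain z where x: "x = homology_class X f n z" and z: "Poly_Mapping.keys z \<subseteq> X n"
    by (auto simp: carrier_face_homology face_cycles_def face_chain_group_def)
  have "frag_extend (frag_of \<circ> \<phi>) (frag_extend (t n) z) = frag_cmul (int N) z"
    using z by (induction z rule: frag_induction)
      (simp_all add: comp[unfolded o_def] frag_extend_diff frag_cmul_diff_right o_def)
  then show "face_homology_map X f \<phi> n (linear_homology_map Y F (t n) n x)
    = x [^]\<^bsub>face_homology X f n\<^esub> N"
    by (simp add: x face_homology_map_eq pow_face_homology
        linear_homology_map_class[OF face_chain_map_boundaries[OF t]]
        linear_homology_map_class[OF face_chain_map_boundaries[OF \<phi>]])
qed

text \<open>
  Here \<open>\<phi>\<close> is the forgetful map from the generators \<open>Y n\<close> to the generators \<open>X n\<close>, and \<open>act n\<close> is an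
  action whose orbits on \<open>V n\<close> are the fibres of \<open>\<phi>\<close>. The larger set \<open>V n\<close> of candidate lifts, from
  which \<open>Y n\<close> is cut out by the condition on the image under \<open>\<phi>\<close>, allows the transfer of a face to
  be computed from the face of a lift without showing that faces of generators are again generators.
\<close>

lemma homology_transfer_of_symmetric_group_action:
  fixes act :: "nat \<Rightarrow> ('s \<Rightarrow> 's) \<Rightarrow> 'b \<Rightarrow> 'b"
  assumes fin: "finite S"
    and lift: "\<And>n x. x \<in> X n \<Longrightarrow> \<exists>y\<in>V n. \<phi> y = x"
    and Y: "\<And>n y. y \<in> Y n \<longleftrightarrow> y \<in> V n \<and> \<phi> y \<in> X n"
    and V_act: "\<And>n \<sigma> y. \<lbrakk>\<sigma> permutes S; y \<in> V n\<rbrakk> \<Longrightarrow> act n \<sigma> y \<in> V n"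
    and \<phi>_act: "\<And>n \<sigma> y. \<lbrakk>\<sigma> permutes S; y \<in> V n\<rbrakk> \<Longrightarrow> \<phi> (act n \<sigma> y) = \<phi> y"
    and act_comp: "\<And>n \<sigma> \<tau> y. \<lbrakk>\<sigma> permutes S; \<tau> permutes S; y \<in> V n\<rbrakk>
                     \<Longrightarrow> act n \<sigma> (act n \<tau> y) = act n (\<sigma> \<circ> \<tau>) y"
    and trans: "\<And>n y y'. \<lbrakk>y \<in> V n; y' \<in> V n; \<phi> y = \<phi> y'\<rbrakk> \<Longrightarrow> \<exists>\<tau>. \<tau> permutes S \<and> y' = act n \<tau> y"
    and V_face: "\<And>n i y. \<lbrakk>y \<in> Y (Suc n); i \<le> Suc n\<rbrakk> \<Longrightarrow> F (Suc n) i y \<in> V n"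
    and \<phi>_face: "\<And>n i y. \<lbrakk>y \<in> Y (Suc n); i \<le> Suc n\<rbrakk> \<Longrightarrow> \<phi> (F (Suc n) i y) = f (Suc n) i (\<phi> y)"
    and act_face: "\<And>n i \<sigma> y. \<lbrakk>\<sigma> permutes S; y \<in> Y (Suc n); i \<le> Suc n\<rbrakk>
                     \<Longrightarrow> F (Suc n) i (act (Suc n) \<sigma> y) = act n \<sigma> (F (Suc n) i y)"
  shows "\<exists>tr. \<forall>n. tr n \<in> hom (face_homology X f n) (face_homology Y F n) \<and>
           (\<forall>x \<in> carrier (face_homology X f n).
              face_homology_map X f \<phi> n (tr n x)
                = x [^]\<^bsub>face_homology X f n\<^esub> (fact (card S) :: nat))"
proof -
  define P where "P = {\<sigma>. \<sigma> permutes S}"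
  have finP: "finite P" unfolding P_def by (rule finite_permutations[OF fin])
  define orbit_sum where "orbit_sum n y = (\<Sum>\<sigma>\<in>P. frag_of (act n \<sigma> y))" for n y
  have orbit_sum_act: "orbit_sum n (act n \<tau> y) = orbit_sum n y" if "\<tau> permutes S" "y \<in> V n"
    for n \<tau> y
  proof -
    have "orbit_sum n (act n \<tau> y) = (\<Sum>\<sigma>\<in>P. frag_of (act n (\<sigma> \<circ> \<tau>) y))"
      unfolding orbit_sum_def by (rule sum.cong) (auto simp: P_def act_comp that)
    also have "\<dots> = orbit_sum n y"
      unfolding orbit_sum_def P_def
      using sum_permutations_compose_right[OF that(1), of "\<lambda>\<sigma>. frag_of (act n \<sigma> y)"] by simp
    finally show ?thesis .
  qed
  define t where "t n x = orbit_sum n (SOME y. y \<in> V n \<and> \<phi> y = x)" for n x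
  have t_eq: "t n (\<phi> y) = orbit_sum n y" if y: "y \<in> V n" for n y
  proof -
    define y' where "y' = (SOME y'. y' \<in> V n \<and> \<phi> y' = \<phi> y)"
    have "y' \<in> V n \<and> \<phi> y' = \<phi> y"
      unfolding y'_def by (rule someI[of _ y]) (simp add: y)
    then obtain \<tau> where "\<tau> permutes S" "y' = act n \<tau> y" using trans[OF y, of y'] by auto
    then show ?thesis unfolding t_def y'_def[symmetric] using orbit_sum_act y by simp
  qed
  show ?thesis
  proof (rule homology_transfer_of_chain_transfer[where t = t])
    show "face_chain_map Y F X f (\<lambda>n. frag_of \<circ> \<phi>)"
      by (simp add: face_chain_map_def Y \<phi>_face)
    show "frag_extend (frag_of \<circ> \<phi>) (t n x) = frag_cmul (int (fact (card S))) (frag_of x)"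
      if x: "x \<in> X n" for n x
    proof -
      obtain y where y: "y \<in> V n" "\<phi> y = x" using lift[OF x] by blast
      have "frag_extend (frag_of \<circ> \<phi>) (orbit_sum n y) = (\<Sum>\<sigma>\<in>P. frag_of x)"
        unfolding orbit_sum_def by (subst frag_extend_sum[OF finP])
          (use y in \<open>auto simp: P_def \<phi>_act o_def intro!: sum.cong\<close>)
      also have "\<dots> = frag_cmul (int (card P)) (frag_of x)"
        using finP by (induction P rule: finite_induct) (simp_all add: frag_cmul_distrib)
      finally show ?thesis
        using t_eq[OF y(1)] y(2) card_permutations[OF refl fin] by (simp add: P_def)
    qed
    show "face_chain_map X f Y F t"
      unfolding face_chain_map_def
    proof (intro conjI allI ballI impI)
      fix n x assume x: "x \<in> X n"
      obtain y where y: "y \<in> V n" "\<phi> y = x" using lift[OF x] by blast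
      have "Poly_Mapping.keys (orbit_sum n y) \<subseteq> (\<Union>\<sigma>\<in>P. {act n \<sigma> y})"
        unfolding orbit_sum_def by (rule order_trans[OF keys_sum]) simp
      also have "\<dots> \<subseteq> Y n" using y x by (auto simp: P_def Y V_act \<phi>_act)
      finally show "Poly_Mapping.keys (t n x) \<subseteq> Y n" using t_eq[OF y(1)] y(2) by simp
    next
      fix n x i assume x: "x \<in> X (Suc n)" and i: "i \<le> Suc n"
      obtain y where y: "y \<in> V (Suc n)" "\<phi> y = x" using lift[OF x] by blast
      then have yY: "y \<in> Y (Suc n)" using Y x by simp
      have "frag_extend (frag_of \<circ> F (Suc n) i) (orbit_sum (Suc n) y) = orbit_sum n (F (Suc n) i y)"
        unfolding orbit_sum_def by (subst frag_extend_sum[OF finP])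
          (auto simp: P_def act_face[OF _ yY i] intro!: sum.cong)
      also have "\<dots> = t n (\<phi> (F (Suc n) i y))" by (rule t_eq[OF V_face[OF yY i], symmetric])
      finally show "frag_extend (frag_of \<circ> F (Suc n) i) (t (Suc n) x) = t n (f (Suc n) i x)"
        using t_eq[OF y(1)] y(2) \<phi>_face[OF yY i] by simp
    qed
  qed
qed

section \<open>Cycles, ghost surfaces and the outer permutation\<close>

text \<open>
  Renaming acts on permutations by conjugation, which carries cycles to cycles; the hypothesis
  expresses \<open>g = \<tau> f \<tau>\<^sup>-\<^sup>1\<close> without the inverse.
\<close>

lemma orbit_conjugate:
  assumes "\<And>x. g (\<tau> x) = \<tau> (f x)"
  shows "orbit g (\<tau> x) = \<tau> ` orbit f x"
proof
  show "orbit g (\<tau> x) \<subseteq> \<tau> ` orbit f x"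
  proof
    fix y assume "y \<in> orbit g (\<tau> x)"
    then show "y \<in> \<tau> ` orbit f x"
      by induction (auto simp: assms intro: orbit.intros)
  qed
  show "\<tau> ` orbit f x \<subseteq> orbit g (\<tau> x)"
  proof (rule image_subsetI)
    fix y assume "y \<in> orbit f x"
    then show "\<tau> y \<in> orbit g (\<tau> x)"
      by induction (auto simp: assms[symmetric] intro: orbit.intros)
  qed
qed

text \<open>
  The sets of cycles of the ghost surfaces partition all cycles, and a ghost surface is determined
  by its set of cycles; hence the description in \<open>surface_of\<close> is proper.
\<close>

lemma scycles_of_point:
  assumes D: "sullivan_diagram n m D" and x: "x \<in> points n m"
  shows "\<exists>!S. S \<in> ghosts D \<and> orbit (fat D) x \<in> scycles S"
proof -
  have part: "partition_on (perm_cycles (fat D) (points n m)) (scycles ` ghosts D)"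
    and inj: "inj_on scycles (ghosts D)"
    using D by (auto simp: sullivan_diagram_def)
  have "orbit (fat D) x \<in> \<Union> (scycles ` ghosts D)"
    using partition_onD1[OF part] x by (auto simp: perm_cycles_def)
  moreover have "S = S'" if "S \<in> ghosts D" "S' \<in> ghosts D" "C \<in> scycles S" "C \<in> scycles S'"
    for S S' C
  proof -
    have "scycles S = scycles S'"
      using disjointD[OF partition_onD2[OF part], of "scycles S" "scycles S'"] that by blast
    then show ?thesis using inj that by (auto dest: inj_onD)
  qed
  ultimately show ?thesis by blast
qed

lemma surface_of_eqI:
  assumes "sullivan_diagram n m D" "x \<in> points n m" "S \<in> ghosts D" "orbit (fat D) x \<in> scycles S"
  shows "surface_of D x = S"
  unfolding surface_of_def
  by (rule the1_equality[OF scycles_of_point[OF assms(1,2)]]) (use assms in auto)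

lemma surface_of_mem:
  assumes "sullivan_diagram n m D" "x \<in> points n m"
  shows "surface_of D x \<in> ghosts D" "orbit (fat D) x \<in> scycles (surface_of D x)"
  using theI'[OF scycles_of_point[OF assms]] by (auto simp: surface_of_def)

lemma bij_long_cycle: "bij (long_cycle n)"
proof (rule o_bij)
  let ?g = "\<lambda>x. case x of Pt j \<Rightarrow> (if j
    = 0 then Pt n else if j \<le> n then Pt (j - 1) else Pt j) | Leaf k \<Rightarrow> Leaf k"
  show "?g \<circ> long_cycle n = id"
  proof
    fix x show "(?g \<circ> long_cycle n) x = id x"
      by (cases x) (auto simp: mod_Suc)
  qed
  show "long_cycle n \<circ> ?g = id"
  proof
    fix x show "(long_cycle n \<circ> ?g) x = id x"
      by (cases x) (auto simp: mod_Suc)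
  qed
qed

lemma long_cycle_permutes: "long_cycle n permutes points n m"
  unfolding permutes_def
proof (intro conjI allI impI)
  fix x assume "x \<notin> points n m" then show "long_cycle n x = x"
    by (cases x) (auto simp: points_def)
qed (use bij_long_cycle in \<open>simp add: bij_iff\<close>)

lemma outer_permutes:
  assumes "fat D permutes points n m" 
  shows "outer n D permutes points n m"
  unfolding outer_def by (intro permutes_compose long_cycle_permutes permutes_inv assms)

text \<open>
  The defining relation \<open>\<lambda> \<circ> \<rho> = (0 1 \<dots> n)\<close>, which avoids inverses in later computations.
\<close>

lemma fat_outer:
  assumes "bij (fat D)"
  shows "fat D (outer n D x) = long_cycle n x"
  using assms by (simp add: outer_def bij_is_surj surj_f_inv_f)

section \<open>Renaming leaves\<close>

context
  fixes \<tau> :: "point \<Rightarrow> point" and m :: nat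
  assumes \<tau>: "\<tau> permutes leaves m"
begin

lemma rename_Pt: "\<tau> (Pt j) = Pt j"
  using permutes_not_in[OF \<tau>, of "Pt j"] by (auto simp: leaves_def)

lemma rename_eq_Pt_iff: "\<tau> x = Pt j \<longleftrightarrow> x = Pt j"
  using rename_Pt permutes_inj[OF \<tau>] by (metis injD)

lemma rename_Leaf: "\<exists>k'. \<tau> (Leaf k) = Leaf k'"
  by (cases "\<tau> (Leaf k)") (auto simp: rename_eq_Pt_iff)

text \<open>
  The long cycle, renumbering and skipping move only points that are not leaves, whereas a
  renaming of leaves moves only leaves. This is the source of all equivariance statements.
\<close>

lemma rename_commutes:
  shows rename_long_cycle: "long_cycle n (\<tau> x) = \<tau> (long_cycle n x)"
    and rename_renumber: "renumber i (\<tau> x) = \<tau> (renumber i x)"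
    and rename_skip: "skip i (\<tau> x) = \<tau> (skip i x)"
proof -
  have "long_cycle n (\<tau> x) = \<tau> (long_cycle n x) \<and> renumber i (\<tau> x) = \<tau> (renumber i x)
      \<and> skip i (\<tau> x) = \<tau> (skip i x)"
  proof (cases x)
    case (Pt j)
    then show ?thesis by (simp add: rename_Pt)
  next
    case (Leaf k)
    obtain k' where "\<tau> (Leaf k) = Leaf k'" using rename_Leaf by blast
    then show ?thesis by (simp add: Leaf)
  qed
  then show "long_cycle n (\<tau> x) = \<tau> (long_cycle n x)" "renumber i (\<tau> x) = \<tau> (renumber i x)"
    "skip i (\<tau> x) = \<tau> (skip i x)" by auto
qed

lemma inj_rename: "inj \<tau>" by (rule permutes_inj[OF \<tau>])

lemma rename_inv: "inv_into UNIV \<tau> (\<tau> x) = x" "\<tau> (inv_into UNIV \<tau> x) = x"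
  by (simp_all add: permutes_inverses[OF \<tau>])

lemma fat_rename_leaves: "fat (rename_leaves \<tau> D) (\<tau> x) = \<tau> (fat D x)"
  by (simp add: rename_leaves_def rename_inv)

lemma ghosts_rename_leaves: "ghosts (rename_leaves \<tau> D) = rename_surface \<tau> ` ghosts D"
  by (simp add: rename_leaves_def)

lemma inj_image_rename: "inj ((`) \<tau>)"
  by (rule injI) (simp add: inj_image_eq_iff[OF inj_rename])

lemma inj_image_image_rename: "inj ((`) ((`) \<tau>))"
  by (rule injI) (simp add: inj_image_eq_iff[OF inj_image_rename])

lemma inj_rename_surface: "inj (rename_surface \<tau>)"
  by (rule injI) (auto simp: rename_surface_def surface.expand dest: injD[OF
    inj_image_image_rename])

lemma rename_surface_simps [simp]:
  "sgenus (rename_surface \<tau> S) = sgenus S" "spunct (rename_surface \<tau> S) = spunct S"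
  "scycles (rename_surface \<tau> S) = (`) \<tau> ` scycles S"
  "rename_surface \<tau> (Surface a b c) = Surface a b ((`) \<tau> ` c)"
  by (simp_all add: rename_surface_def)

lemma bij_fat_rename_leaves:
  assumes "bij (fat D)" shows "bij (fat (rename_leaves \<tau> D))"
  unfolding rename_leaves_def using assms permutes_bij[OF \<tau>] by (simp add: bij_comp bij_imp_bij_inv)

lemma outer_rename_leaves:
  assumes "bij (fat D)"
  shows "outer n (rename_leaves \<tau> D) (\<tau> x) = \<tau> (outer n D x)"
proof -
  have "fat (rename_leaves \<tau> D) (outer n (rename_leaves \<tau> D) (\<tau> x))
      = fat (rename_leaves \<tau> D) (\<tau> (outer n D x))"
    by (simp only: fat_outer[OF assms] fat_outer[OF bij_fat_rename_leaves[OF assms]]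
        fat_rename_leaves rename_long_cycle)
  then show ?thesis
    using bij_is_inj[OF bij_fat_rename_leaves[OF assms]] by (simp add: inj_eq)
qed

lemma rename_leaves_permutes_points: "\<tau> permutes points n m"
  by (rule permutes_subset[OF \<tau>]) (simp add: points_def)

lemma perm_cycles_rename:
  assumes "\<And>x. g (\<tau> x) = \<tau> (f x)"
  shows "perm_cycles g (points n m) = (`) \<tau> ` perm_cycles f (points n m)"
proof -
  have "perm_cycles g (points n m) = orbit g ` \<tau> ` points n m"
    by (simp add: perm_cycles_def permutes_image[OF rename_leaves_permutes_points])
  also have "\<dots> = (`) \<tau> ` perm_cycles f (points n m)"
    by (simp add: perm_cycles_def image_image orbit_conjugate[of g \<tau> f, OF assms])
  finally show ?thesis .
qed

lemma sullivan_diagram_rename_leaves: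
  assumes "sullivan_diagram n m D"
  shows "sullivan_diagram n m (rename_leaves \<tau> D)"
  unfolding sullivan_diagram_def
proof (intro conjI ballI allI impI)
  show "fat (rename_leaves \<tau> D) permutes points n m"
    using assms rename_leaves_permutes_points
    by (auto simp: rename_leaves_def sullivan_diagram_def intro!: permutes_compose permutes_inv)
  show "inj_on scycles (ghosts (rename_leaves \<tau> D))"
  proof (rule inj_onI)
    fix S T assume "S \<in> ghosts (rename_leaves \<tau> D)" "T \<in> ghosts (rename_leaves \<tau> D)"
      "scycles S = scycles T"
    then obtain S0 T0 where S0: "S0 \<in> ghosts D" "S = rename_surface \<tau> S0"
        and T0: "T0 \<in> ghosts D" "T = rename_surface \<tau> T0"
      unfolding ghosts_rename_leaves by blast
    then have "(`) ((`) \<tau>) (scycles S0) = (`) ((`) \<tau>) (scycles T0)"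
      using \<open>scycles S = scycles T\<close> by simp
    then have "scycles S0 = scycles T0" by (rule injD[OF inj_image_image_rename])
    with S0 T0 show "S = T"
      using assms by (auto simp: sullivan_diagram_def dest: inj_onD)
  qed
  have "partition_on ((`) \<tau> ` perm_cycles (fat D) (points n m)) ((`) ((`) \<tau>) ` scycles ` ghosts D)"
  proof -
    have part: "partition_on (perm_cycles (fat D) (points n m)) (scycles ` ghosts D)"
      using assms by (simp add: sullivan_diagram_def)
    then have "{} \<notin> (`) ((`) \<tau>) ` scycles ` ghosts D"
      using partition_onD3 by fastforce
    then show ?thesis
      using partition_on_inj_image[OF part inj_on_subset[OF inj_image_rename]] by simp
  qed
  then show "partition_on (perm_cycles (fat (rename_leaves \<tau> D)) (points n m))
      (scycles ` ghosts (rename_leaves \<tau> D))"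
    by (simp add: perm_cycles_rename[of "fat (rename_leaves \<tau> D)" "fat D", OF fat_rename_leaves]
        ghosts_rename_leaves image_image)
  fix S r assume S: "S \<in> ghosts (rename_leaves \<tau> D)" "S = Surface 0 0 {{r}}"
  then obtain S0 where S0: "S0 \<in> ghosts D" "S = rename_surface \<tau> S0"
    by (auto simp: ghosts_rename_leaves)
  have "rename_surface \<tau> S0 = rename_surface \<tau> (Surface 0 0 {{inv_into UNIV \<tau> r}})"
    using S S0 by (simp add: rename_inv)
  then have "S0 = Surface 0 0 {{inv_into UNIV \<tau> r}}" by (rule injD[OF inj_rename_surface])
  then have "inv_into UNIV \<tau> r = Pt 0" using assms S0 by (auto simp: sullivan_diagram_def)
  then have "\<tau> (inv_into UNIV \<tau> r) = \<tau> (Pt 0)" by simp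
  then show "r = Pt 0" by (simp add: rename_inv rename_Pt)
qed

lemma rename_leaves_par_enum:
  assumes "D \<in> par_enum g m n"
  shows "rename_leaves \<tau> D \<in> par_enum g m n"
proof -
  have D: "sullivan_diagram n m D" 
    and gh: "\<forall>S\<in>ghosts D. spunct S = 0 \<and> (\<exists>C\<in>scycles S. C \<inter> Pt ` {..n} \<noteq> {})"
    and out: "\<forall>C\<in>perm_cycles (outer n D) (points n m). \<exists>!l. l \<in> C \<inter> leaves m"
    and genus: "has_genus n m g D" using assms by (auto simp: par_enum_def)
  have bij: "bij (fat D)" using D permutes_bij by (auto simp: sullivan_diagram_def)
  show ?thesis unfolding par_enum_def
  proof (intro CollectI conjI ballI)
    show "sullivan_diagram n m (rename_leaves \<tau> D)" by (rule sullivan_diagram_rename_leaves[OF D])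
    show "has_genus n m g (rename_leaves \<tau> D)"
      using genus unfolding has_genus_def ghosts_rename_leaves
      by (simp add: sum.reindex inj_on_subset[OF inj_rename_surface] card_image inj_on_subset[OF
        inj_image_rename])
  next
    fix S assume "S \<in> ghosts (rename_leaves \<tau> D)"
    then obtain S0 where S0: "S0 \<in> ghosts D" "S = rename_surface \<tau> S0"
      by (auto simp: ghosts_rename_leaves)
    then show "spunct S = 0" using gh by simp
    obtain C j where "C \<in> scycles S0" "Pt j \<in> C" "j \<le> n" using gh S0(1) by blast
    then show "\<exists>C\<in>scycles S. C \<inter> Pt ` {..n} \<noteq> {}"
      using S0(2) rename_Pt by (intro bexI[of _ "\<tau> ` C"]) (auto simp: image_iff disjoint_iff)
  next
    fix C assume "C \<in> perm_cycles (outer n (rename_leaves \<tau> D)) (points n m)"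
    then obtain C0 where C0: "C0 \<in> perm_cycles (outer n D) (points n m)" "C = \<tau> ` C0"
      using perm_cycles_rename[of "outer n (rename_leaves \<tau> D)"
        "outer n D", OF outer_rename_leaves[OF bij]] by auto
    have "\<exists>!l. l \<in> C0 \<inter> leaves m" using out C0(1) by (rule bspec)
    then obtain l where l: "C0 \<inter> leaves m = {l}" by (elim ex1E) blast
    have "C \<inter> leaves m = \<tau> ` (C0 \<inter> leaves m)"
      using inj_rename permutes_image[OF \<tau>] by (simp add: C0(2) image_Int)
    then show "\<exists>!l. l \<in> C \<inter> leaves m" using l by auto
  qed
qed

lemma delete_cycle_rename: "delete_cycle i (\<tau> ` C) = \<tau> ` delete_cycle i C"
proof -
  have "\<tau> ` C - {Pt i} = \<tau> ` (C - {Pt i})" using rename_eq_Pt_iff by auto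
  then show ?thesis by (simp add: delete_cycle_def image_image rename_renumber)
qed

lemma delete_surface_rename: "delete_surface i (rename_surface \<tau> S)
  = rename_surface \<tau> (delete_surface i S)"
  by (simp add: delete_surface_def image_image delete_cycle_rename)

lemma surface_of_rename_leaves:
  assumes D: "sullivan_diagram n m D" and x: "x \<in> points n m"
  shows "surface_of (rename_leaves \<tau> D) (\<tau> x) = rename_surface \<tau> (surface_of D x)"
proof (rule surface_of_eqI[OF sullivan_diagram_rename_leaves[OF D]])
  show "\<tau> x \<in> points n m" by (simp add: x permutes_in_image[OF rename_leaves_permutes_points])
  show "rename_surface \<tau> (surface_of D x) \<in> ghosts (rename_leaves \<tau> D)"
    using surface_of_mem[OF D x] by (simp add: ghosts_rename_leaves)
  show "orbit (fat (rename_leaves \<tau> D)) (\<tau> x) \<in> scycles (rename_surface \<tau> (surface_of D x))"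
    using surface_of_mem[OF D x]
      by (simp add: orbit_conjugate[of "fat (rename_leaves \<tau> D)" \<tau> "fat D", OF fat_rename_leaves])
qed

lemma face_fat_rename_leaves:
  assumes "bij (fat D)"
  shows "face_fat n i (rename_leaves \<tau> D) (\<tau> x) = \<tau> (face_fat n i D x)"
proof -
  have "transpose (Pt i) (outer n (rename_leaves \<tau> D) (Pt i)) (\<tau> x)
    = \<tau> (transpose (Pt i) (outer n D (Pt i)) x)"
    using outer_rename_leaves[OF assms, of n "Pt i"] inj_eq[OF inj_rename]
    by (auto simp: transpose_def rename_Pt rename_eq_Pt_iff)
  then show ?thesis by (simp add: face_fat_def fat_rename_leaves)
qed

text \<open>
  Each case distinction in the construction of a face is made on equalities between cycles, points
  or surfaces, and injectivity of renaming shows that it has the same outcome before and after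
  renaming.
\<close>

lemma face_surface_rename_leaves:
  assumes D: "sullivan_diagram n m D" and i: "i \<le> n"
  shows "face_surface n i (rename_leaves \<tau> D) (rename_surface \<tau> S)
    = rename_surface \<tau> (face_surface n i D S)"
proof -
  have perm: "fat D permutes points n m" using D by (simp add: sullivan_diagram_def)
  then have bij: "bij (fat D)" by (rule permutes_bij)
  define a where "a = outer n D (Pt i)"
  have i': "Pt i \<in> points n m" using i by (simp add: points_def)
  then have a': "a \<in> points n m" unfolding a_def
    by (simp add: permutes_in_image[OF outer_permutes[OF perm]])
  have a: "outer n (rename_leaves \<tau> D) (Pt i) = \<tau> a"
    using outer_rename_leaves[OF bij, of n "Pt i"] by (simp add: rename_Pt a_def)
  have orb: "orbit (fat (rename_leaves \<tau> D)) (\<tau> x) = \<tau> ` orbit (fat D) x" for x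
    by (rule orbit_conjugate) (rule fat_rename_leaves)
  have orbq: "orbit (face_fat n i (rename_leaves \<tau> D)) (\<tau> x) = \<tau> ` orbit (face_fat n i D) x" for x
    by (rule orbit_conjugate) (rule face_fat_rename_leaves[OF bij])
  note at_i = orb[of "Pt i", unfolded rename_Pt] orbq[of "Pt i", unfolded rename_Pt]
    surface_of_rename_leaves[OF D i', unfolded rename_Pt]
  show ?thesis
    unfolding face_surface_def Let_def a a_def[symmetric] at_i orb orbq
      surface_of_rename_leaves[OF D a']
      inj_eq[OF inj_rename_surface] inj_eq[OF inj_image_rename] rename_eq_Pt_iff
    by (simp only: if_distrib[of "rename_surface \<tau>"] rename_surface_simps image_Un image_insert
        image_empty image_set_diff[OF inj_image_rename] insert_iff empty_iff inj_eq[OF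
          inj_rename_surface])
qed

lemma face_rename_leaves:
  assumes D: "sullivan_diagram n m D" and i: "i \<le> n"
  shows "face n i (rename_leaves \<tau> D) = rename_leaves \<tau> (face n i D)"
proof (rule diagram.expand, rule conjI)
  have bij: "bij (fat D)" using D permutes_bij by (auto simp: sullivan_diagram_def)
  have del: "delete_perm i (face_fat n i (rename_leaves \<tau> D)) (\<tau> x)
    = \<tau> (delete_perm i (face_fat n i D) x)" for x
    using face_fat_rename_leaves[OF bij, of n i "Pt i"]
    by (simp add: delete_perm_def rename_skip face_fat_rename_leaves[OF bij] rename_eq_Pt_iff
      rename_Pt
        rename_renumber)
  show "fat (face n i (rename_leaves \<tau> D)) = fat (rename_leaves \<tau> (face n i D))"
  proof
    fix y
    have "fat (face n i (rename_leaves \<tau> D)) (\<tau> (inv_into UNIV \<tau> y))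
      = fat (rename_leaves \<tau> (face n i D)) (\<tau> (inv_into UNIV \<tau> y))"
      unfolding fat_rename_leaves by (simp only: face_def diagram.sel del)
    then show "fat (face n i (rename_leaves \<tau> D)) y = fat (rename_leaves \<tau> (face n i D)) y"
      by (simp only: rename_inv)
  qed
  show "ghosts (face n i (rename_leaves \<tau> D)) = ghosts (rename_leaves \<tau> (face n i D))"
    unfolding ghosts_rename_leaves face_def diagram.sel image_image
    by (rule image_cong) (simp_all add: face_ghost_def face_surface_rename_leaves[OF D i]
      delete_surface_rename)
qed

end

lemma rename_leaves_comp:
  assumes "\<sigma> permutes leaves m" "\<tau> permutes leaves m"
  shows "rename_leaves \<sigma> (rename_leaves \<tau> D) = rename_leaves (\<sigma> \<circ> \<tau>) D"
  using assms
  by (simp add: rename_leaves_def rename_surface_def image_image image_comp[symmetric]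
    o_inv_distrib permutes_bij comp_assoc)

lemma rename_leaves_id: "rename_leaves id D = D"
  by (simp add: rename_leaves_def rename_surface_def)

text \<open>
  Orbits of a group action are equal as soon as they meet.
\<close>

lemma leaf_orbit_eq_iff:
  "leaf_orbit m D = leaf_orbit m D' \<longleftrightarrow> (\<exists>\<tau>. \<tau> permutes leaves m \<and> D' = rename_leaves \<tau> D)"
proof
  assume "leaf_orbit m D = leaf_orbit m D'"
  moreover have "rename_leaves id D' \<in> leaf_orbit m D'"
    unfolding leaf_orbit_def using permutes_id by blast
  ultimately show "\<exists>\<tau>. \<tau> permutes leaves m \<and> D' = rename_leaves \<tau> D"
    by (auto simp: leaf_orbit_def rename_leaves_id)
next
  assume "\<exists>\<tau>. \<tau> permutes leaves m \<and> D' = rename_leaves \<tau> D"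
  then obtain \<tau> where \<tau>: "\<tau> permutes leaves m" "D' = rename_leaves \<tau> D" by blast
  have "leaf_orbit m D' = (\<lambda>\<sigma>. rename_leaves \<sigma> D) ` {\<sigma> \<circ> \<tau> |\<sigma>. \<sigma> permutes leaves m}"
    unfolding leaf_orbit_def \<tau>(2)
    by (auto simp: rename_leaves_comp[OF _ \<tau>(1), symmetric] image_iff) (metis
      rename_leaves_comp[OF _ \<tau>(1)])
  then show "leaf_orbit m D = leaf_orbit m D'"
    unfolding image_compose_permutations_right[OF \<tau>(1)] by (auto simp: leaf_orbit_def)
qed

section \<open>Enumerating punctures\<close>

lemma finite_points: "finite (points n m)"
  by (simp add: points_def leaves_def)

abbreviation outer_cycles :: "nat \<Rightarrow> diagram \<Rightarrow> point set set" where
  "outer_cycles n D \<equiv> perm_cycles (outer n D) (points n 0)"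

definition ghost_labels :: "nat \<Rightarrow> nat \<Rightarrow> enum_diagram \<Rightarrow> nat set" where
  "ghost_labels m n E = {1..m} - enum_cycles E ` outer_cycles n (underlying E)"

text \<open>
  Enumerations \<open>(\<beta>\<^sub>1, \<beta>\<^sub>2)\<close> of a diagram on which no condition is imposed. Separating them from the
  conditions on the diagram makes it possible to treat the face of an enumeration without treating
  the genus and the degeneracy condition of the face.
\<close>

definition puncture_enumerations :: "nat \<Rightarrow> nat \<Rightarrow> enum_diagram set" where
  "puncture_enumerations m n =
     {E. enum_cycles E \<in> outer_cycles n (underlying E) \<rightarrow>\<^sub>E {1..m} \<and>
         inj_on (enum_cycles E) (outer_cycles n (underlying E)) \<and>
         enum_ghosts E \<in> ghost_labels m n E \<rightarrow>\<^sub>E ghosts (underlying E) \<and>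
         (\<forall>S\<in>ghosts (underlying E). card {l \<in> ghost_labels m n E. enum_ghosts E l = S} = spunct S)}"

lemma unpar_enum_iff:
  "E \<in> unpar_enum g m n \<longleftrightarrow> E \<in> puncture_enumerations m n \<and> underlying E \<in> unpar_unenum g m n"
  by (auto simp: unpar_enum_def puncture_enumerations_def ghost_labels_def Let_def)

text \<open>
  The action \<open>(\<beta>\<^sub>1, \<beta>\<^sub>2) \<mapsto> (\<sigma> \<circ> \<beta>\<^sub>1, \<beta>\<^sub>2 \<circ> \<sigma>\<^sup>-\<^sup>1)\<close>. The restrictions restore the value
  \<open>undefined\<close> outside the domains, which a permutation need not fix.
\<close>

definition relabel :: "nat \<Rightarrow> nat \<Rightarrow> (nat \<Rightarrow> nat) \<Rightarrow> enum_diagram \<Rightarrow> enum_diagram" where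
  "relabel m n \<sigma> E =
     Enum_Diagram (underlying E)
       (restrict (\<sigma> \<circ> enum_cycles E) (outer_cycles n (underlying E)))
       (restrict (enum_ghosts E \<circ> inv_into UNIV \<sigma>) (\<sigma> ` ghost_labels m n E))"

lemma underlying_relabel [simp]: "underlying (relabel m n \<sigma> E) = underlying E"
  by (simp add: relabel_def)

lemma ghost_labels_relabel:
  assumes "\<sigma> permutes {1..m}"
  shows "ghost_labels m n (relabel m n \<sigma> E) = \<sigma> ` ghost_labels m n E"
proof -
  have "{1..m} - (\<lambda>c. \<sigma> (enum_cycles E c)) ` outer_cycles n (underlying E)
      = \<sigma> ` {1..m} - \<sigma> ` enum_cycles E ` outer_cycles n (underlying E)"
    by (simp only: permutes_image[OF assms] image_image)
  also have "\<dots> = \<sigma> ` ghost_labels m n E"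
    by (simp add: ghost_labels_def image_set_diff[OF permutes_inj[OF assms]])
  finally show ?thesis by (simp add: ghost_labels_def relabel_def)
qed

lemma relabel_in_puncture_enumerations:
  assumes \<sigma>: "\<sigma> permutes {1..m}" and E: "E \<in> puncture_enumerations m n"
  shows "relabel m n \<sigma> E \<in> puncture_enumerations m n"
proof -
  have "card {l \<in> \<sigma> ` ghost_labels m n E. enum_ghosts (relabel m n \<sigma> E) l = S} =
        card {l \<in> ghost_labels m n E. enum_ghosts E l = S}" for S
  proof -
    have "{l \<in> \<sigma> ` ghost_labels m n E. enum_ghosts (relabel m n \<sigma> E) l = S}
       = \<sigma> ` {l \<in> ghost_labels m n E. enum_ghosts E l = S}"
      by (auto simp: relabel_def permutes_inverses[OF \<sigma>] inj_eq[OF permutes_inj[OF \<sigma>]])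
    then show ?thesis by (simp add: card_image inj_on_subset[OF permutes_inj[OF \<sigma>]])
  qed
  moreover have "enum_cycles (relabel m n \<sigma> E) \<in> outer_cycles n (underlying E) \<rightarrow>\<^sub>E {1..m}"
  proof (rule PiE_I)
    fix c assume "c \<in> outer_cycles n (underlying E)"
    then have "enum_cycles E c \<in> {1..m}" using E unfolding puncture_enumerations_def by blast
    then show "enum_cycles (relabel m n \<sigma> E) c \<in> {1..m}"
      using \<open>c \<in> _\<close> permutes_in_image[OF \<sigma>] by (simp add: relabel_def)
  qed (simp add: relabel_def)
  moreover have "inj_on (enum_cycles (relabel m n \<sigma> E)) (outer_cycles n (underlying E))"
    using E by (simp add: puncture_enumerations_def relabel_def comp_inj_on inj_on_subset[OF
      permutes_inj[OF \<sigma>]])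
  moreover have "enum_ghosts (relabel m n \<sigma> E) \<in> \<sigma> ` ghost_labels m n E \<rightarrow>\<^sub>E ghosts (underlying E)"
    using E by (auto simp: puncture_enumerations_def relabel_def permutes_inverses[OF \<sigma>])
  ultimately show ?thesis
    using E by (simp add: puncture_enumerations_def ghost_labels_relabel[OF \<sigma>])
qed

lemma relabel_comp:
  assumes \<sigma>: "\<sigma> permutes {1..m}" and \<tau>: "\<tau> permutes {1..m}"
  shows "relabel m n \<sigma> (relabel m n \<tau> E) = relabel m n (\<sigma> \<circ> \<tau>) E"
proof (rule enum_diagram.expand, intro conjI)
  show "enum_ghosts (relabel m n \<sigma> (relabel m n \<tau> E)) = enum_ghosts (relabel m n (\<sigma> \<circ> \<tau>) E)"
    unfolding relabel_def[of m n \<sigma> "relabel m n \<tau> E"] ghost_labels_relabel[OF \<tau>]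
    by (auto simp: relabel_def fun_eq_iff restrict_def permutes_inverses[OF \<sigma>]
      permutes_inverses[OF \<tau>]
        o_inv_distrib permutes_bij[OF \<sigma>] permutes_bij[OF \<tau>] image_comp)
qed (auto simp: relabel_def fun_eq_iff restrict_def)

text \<open>
  An enumeration places every label at a cycle or at a ghost surface. The number of labels at each
  place (one at a cycle, the number of punctures at a ghost surface) depends only on the diagram, so
  the place functions of two enumerations of the same diagram have the same multiset of values and
  differ by a permutation of the labels.
\<close>

lemma puncture_enumerations_transitive:
  assumes E: "E \<in> puncture_enumerations m n" and E': "E' \<in> puncture_enumerations m n"
    and eq: "underlying E = underlying E'"
  shows "\<exists>\<sigma>. \<sigma> permutes {1..m} \<and> E' = relabel m n \<sigma> E"
proof -
  define C where "C = outer_cycles n (underlying E)"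
  define place where "place E l = (if l \<in> enum_cycles E ` C then Inl (inv_into C (enum_cycles E) l)
      else Inr (enum_ghosts E l))" for E l
  have place_cycle: "l \<in> {1..m} \<and> place X l = Inl c \<longleftrightarrow> c \<in> C \<and> l = enum_cycles X c"
    if "X \<in> puncture_enumerations m n" "underlying X = underlying E" for X l c
    using that by (auto simp: puncture_enumerations_def place_def C_def)
  have place_ghost: "l \<in> {1..m} \<and> place X l = Inr S \<longleftrightarrow> l \<in> ghost_labels m n X \<and> enum_ghosts X l = S"
    if "X \<in> puncture_enumerations m n" "underlying X = underlying E" for X l S
    using that by (auto simp: puncture_enumerations_def place_def C_def ghost_labels_def)
  have fibre: "card {l \<in> {1..m}. place X l = p} =
      (case p of Inl c \<Rightarrow> (if c \<in> C then 1 else 0) | Inr S \<Rightarrow> (if S \<in> ghosts (underlying E) then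
        spunct S else 0))"
    if X: "X \<in> puncture_enumerations m n" "underlying X = underlying E" for X p
  proof (cases p)
    case (Inl c)
    have "{l \<in> {1..m}. place X l = p} = (if c \<in> C then {enum_cycles X c} else {})"
      unfolding Inl place_cycle[OF X] by auto
    then show ?thesis by (simp add: Inl)
  next
    case (Inr S)
    have "{l \<in> {1..m}. place X l = p} = {l \<in> ghost_labels m n X. enum_ghosts X l = S}"
      unfolding Inr place_ghost[OF X] by auto
    moreover have "{l \<in> ghost_labels m n X. enum_ghosts X l = S} = {}" if
      "S \<notin> ghosts (underlying E)"
      using X that by (auto simp: puncture_enumerations_def)
    moreover have "card {l \<in> ghost_labels m n X. enum_ghosts X l = S} = spunct S" if
      "S \<in> ghosts (underlying E)"
      using X that by (simp add: puncture_enumerations_def)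
    ultimately show ?thesis
      unfolding Inr by (cases "S \<in> ghosts (underlying E)")
        (simp_all only: sum.case card.empty simp_thms if_True if_False)
  qed
  have mset_eq: "image_mset (place E) (mset_set {1..m}) = image_mset (place E') (mset_set {1..m})"
  proof (rule multiset_eqI)
    fix p
    have "{l \<in> {1..m}. p = place X l} = {l \<in> {1..m}. place X l = p}" for X by auto
    then show "count (image_mset (place E) (mset_set {1..m})) p
      = count (image_mset (place E') (mset_set {1..m})) p"
      using fibre[OF E refl, of p] fibre[OF E' eq[symmetric], of p] by (simp add: count_image_mset')
  qed
  obtain \<sigma> where \<sigma>: "\<sigma> permutes {1..m}" and place: "\<forall>l\<in>{1..m}. place E l = place E' (\<sigma> l)"
    by (rule image_mset_eq_implies_permutes[OF finite_atLeastAtMost mset_eq])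
  have cyc: "enum_cycles E' c = \<sigma> (enum_cycles E c)" if "c \<in> C" for c
    using place_cycle[OF E refl] place_cycle[OF E' eq[symmetric]] place permutes_in_image[OF \<sigma>] that
    by metis
  have gh: "l \<in> ghost_labels m n E \<and> enum_ghosts E l = S
    \<longleftrightarrow> \<sigma> l \<in> ghost_labels m n E' \<and> enum_ghosts E' (\<sigma> l) = S" for l S
    using place_ghost[OF E refl] place_ghost[OF E' eq[symmetric]] place permutes_in_image[OF \<sigma>] by
      metis
  have ghosts: "enum_ghosts E' (\<sigma> l) = enum_ghosts E l" if "l \<in> ghost_labels m n E" for l
    using gh[of l "enum_ghosts E l"] that by simp
  have labels: "ghost_labels m n E' = \<sigma> ` ghost_labels m n E"
    using gh permutes_inverses(1)[OF \<sigma>] by (auto simp: image_iff) metis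
  have "E' = relabel m n \<sigma> E"
  proof (rule enum_diagram.expand, intro conjI)
    show "underlying E' = underlying (relabel m n \<sigma> E)" by (simp add: eq)
    have "enum_cycles E' \<in> extensional C" 
      using E' by (simp add: puncture_enumerations_def PiE_def C_def eq)
    then show "enum_cycles E' = enum_cycles (relabel m n \<sigma> E)"
      by (auto simp: relabel_def fun_eq_iff restrict_def C_def[symmetric] cyc extensional_def)
    have "enum_ghosts E' \<in> extensional (\<sigma> ` ghost_labels m n E)"
      using E' by (simp add: puncture_enumerations_def PiE_def labels)
    then show "enum_ghosts E' = enum_ghosts (relabel m n \<sigma> E)"
      using ghosts
      by (auto simp: relabel_def fun_eq_iff restrict_def extensional_def permutes_inverses[OF \<sigma>])
  qed
  with \<sigma> show ?thesis by blast
qed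

text \<open>
  The labels left over after labelling the cycles are as many as the slots obtained by splitting
  each ghost surface into its punctures; a bijection with the slots gives \<open>\<beta>\<^sub>2\<close>.
\<close>

lemma puncture_enumeration_exists:
  assumes "sullivan_diagram n 0 D" "num_punctures n D = m"
  shows "\<exists>E \<in> puncture_enumerations m n. underlying E = D"
proof -
  let ?C = "outer_cycles n D"
  have finC: "finite ?C" by (simp add: perm_cycles_def finite_points)
  have "finite (scycles ` ghosts D)"
    using assms(1) by (intro finite_elements[of "perm_cycles (fat D) (points n 0)"])
      (auto simp: sullivan_diagram_def perm_cycles_def finite_points)
  then have fin: "finite (ghosts D)"
    using assms(1) by (auto simp: sullivan_diagram_def dest: finite_imageD)
  have m: "m = card ?C + (\<Sum>S\<in>ghosts D. spunct S)" using assms(2) by (simp add: num_punctures_def)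
  then have "card ?C \<le> card {1..m}" by simp
  then obtain f where f: "inj_on f ?C" "f ` ?C \<subseteq> {1..m}"
    using inj_on_iff_card_le[OF finC, of "{1..m}"] by auto
  define L where "L = {1..m} - f ` ?C"
  define slots where "slots = (SIGMA S:ghosts D. {..<spunct S})"
  have "card L = card slots"
    using f fin by (simp add: L_def slots_def card_Diff_subset finC card_image m)
  moreover have "finite L" "finite slots" by (auto simp: L_def slots_def fin)
  ultimately obtain b where b: "bij_betw b L slots" using finite_same_card_bij by blast
  define E where "E = Enum_Diagram D (restrict f ?C) (restrict (fst \<circ> b) L)"
  have labels: "ghost_labels m n E = L" by (simp add: E_def ghost_labels_def L_def)
  have "card {l \<in> L. enum_ghosts E l = S} = spunct S" if "S \<in> ghosts D" for S
  proof -
    have "b ` {l \<in> L. enum_ghosts E l = S} = {p \<in> slots. fst p = S}"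
      unfolding bij_betw_imp_surj_on[OF b, symmetric] by (auto simp: E_def)
    also have "\<dots> = {S} \<times> {..<spunct S}" using that by (auto simp: slots_def)
    finally have "b ` {l \<in> L. enum_ghosts E l = S} = {S} \<times> {..<spunct S}" .
    moreover have "card (b ` {l \<in> L. enum_ghosts E l = S}) = card {l \<in> L. enum_ghosts E l = S}"
      using bij_betw_imp_inj_on[OF b] by (intro card_image) (rule inj_on_subset, auto)
    ultimately show ?thesis by simp
  qed
  moreover have "enum_ghosts E \<in> L \<rightarrow>\<^sub>E ghosts D"
    using bij_betwE[OF b] by (force simp: E_def slots_def)
  moreover have "enum_cycles E \<in> ?C \<rightarrow>\<^sub>E {1..m}" "inj_on (enum_cycles E) ?C" "underlying E = D"
    using f by (auto simp: E_def)
  ultimately have "E \<in> puncture_enumerations m n"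
    by (simp add: puncture_enumerations_def labels)
  then show ?thesis by (intro bexI[of _ E]) (simp_all add: E_def)
qed

section \<open>Deleting a point from a permutation\<close>

lemma renumber_skip: "renumber i (skip i x) = x"
  by (cases x) auto

lemma skip_renumber: "x \<noteq> Pt i \<Longrightarrow> skip i (renumber i x) = x"
  by (cases x) auto

lemma skip_neq: "skip i x \<noteq> Pt i"
  by (cases x) auto

lemma inj_on_renumber: "inj_on (renumber i) (- {Pt i})"
  by (rule inj_on_inverseI[of _ "skip i"]) (simp add: skip_renumber)

text \<open>
  Read on the points other than \<open>i\<close>, deletion makes the permutation jump over \<open>i\<close>. Injectivity
  excludes that \<open>i\<close> is a fixed point which is jumped to, where the renumbering would be wrong.
\<close>

lemma skip_delete_perm:
  assumes "inj p"
  shows "skip i (delete_perm i p x) = (if p (skip i x) = Pt i then p (Pt i) else p (skip i x))"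
proof (cases "p (skip i x) = Pt i")
  case True
  then have "p (Pt i) \<noteq> Pt i" using injD[OF assms, of "skip i x" "Pt i"] skip_neq by metis
  with True show ?thesis by (simp add: delete_perm_def skip_renumber)
qed (simp add: delete_perm_def skip_renumber)

lemma inj_delete_perm:
  assumes "inj p"
  shows "inj (delete_perm i p)"
proof (rule injI)
  fix x y assume "delete_perm i p x = delete_perm i p y"
  then have "skip i (delete_perm i p x) = skip i (delete_perm i p y)" by simp
  then have "skip i x = skip i y"
    unfolding skip_delete_perm[OF assms] using injD[OF assms] skip_neq by (metis (full_types))
  then show "x = y" by (metis renumber_skip)
qed

text \<open>
  Both inclusions follow the two permutations step by step. An orbit that reaches \<open>i\<close> is continued
  by the image of \<open>i\<close>, which the induction statement for the converse inclusion anticipates.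
\<close>

lemma orbit_delete_perm:
  assumes "inj p"
  shows "orbit (delete_perm i p) x = delete_cycle i (orbit p (skip i x))"
proof -
  let ?q = "delete_perm i p"
  have sub: "skip i y \<in> orbit p (skip i x)" if "y \<in> orbit ?q x" for y
    using that
  proof induction
    case base
    show ?case by (simp add: skip_delete_perm[OF assms]) (metis orbit.intros)
  next
    case (step y)
    then show ?case by (simp add: skip_delete_perm[OF assms]) (metis orbit.intros)
  qed
  have sup: "(y \<noteq> Pt i \<longrightarrow> y \<in> skip i ` orbit ?q x) \<and> (y = Pt i \<longrightarrow> p (Pt i) \<in> skip i ` orbit ?q x)"
    if "y \<in> orbit p (skip i x)" for y
    using that
  proof induction
    case base
    have "skip i (?q x) \<in> skip i ` orbit ?q x" by (intro imageI orbit.intros)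
    then show ?case by (auto simp: skip_delete_perm[OF assms])
  next
    case (step y)
    show ?case
    proof (cases "y = Pt i")
      case True
      with step.IH have "p (Pt i) \<in> skip i ` orbit ?q x" by simp
      then show ?thesis using True by auto
    next
      case False
      with step.IH obtain z where z: "y = skip i z" "z \<in> orbit ?q x" by blast
      then have "skip i (?q z) \<in> skip i ` orbit ?q x" by (intro imageI orbit.intros)
      then show ?thesis using z by (auto simp: skip_delete_perm[OF assms])
    qed
  qed
  have "orbit p (skip i x) - {Pt i} = skip i ` orbit ?q x"
    using sub sup skip_neq by auto
  then show ?thesis by (simp add: delete_cycle_def image_image renumber_skip)
qed

text \<open>
  Deleting a point from the long cycle on \<open>n + 2\<close> points gives the long cycle on \<open>n + 1\<close> points.
\<close>

lemma skip_long_cycle: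
  assumes "i \<le> Suc n"
  shows "skip i (long_cycle n x) =
    (if long_cycle (Suc n) (skip i x)
      = Pt i then long_cycle (Suc n) (Pt i) else long_cycle (Suc n) (skip i x))"
  using assms by (cases x) (auto simp: mod_Suc)

text \<open>
  The face has fat structure \<open>D\<^sub>i(\<lambda> \<circ> (i a))\<close> with \<open>a = \<rho>(i)\<close>. Deletion is not multiplicative in
  general, but it is on the product of \<open>\<lambda> \<circ> (i a)\<close> and \<open>\<rho>\<close>: when the second factor jumps over
  \<open>i\<close> it arrives at \<open>a\<close>, where the transposition substitutes \<open>\<lambda>(i)\<close>, and otherwise the
  transposition is not felt. So the product of the two deleted permutations is the shorter long cycle.
\<close>

lemma outer_face:
  assumes bij: "bij (fat D)" and i: "i \<le> Suc n"
  shows "outer n (face (Suc n) i D) = delete_perm i (outer (Suc n) D)"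
proof
  fix x
  let ?\<rho> = "outer (Suc n) D" and ?q = "face_fat (Suc n) i D"
  have inj\<rho>: "inj ?\<rho>"
    unfolding outer_def by (intro inj_compose bij_is_inj bij_imp_bij_inv bij bij_long_cycle)
  have injq: "inj ?q"
    unfolding face_fat_def by (intro inj_compose bij_is_inj[OF bij] bij_is_inj[OF bij_swap]) simp
  have q_i: "?q (Pt i) = long_cycle (Suc n) (Pt i)"
    by (simp add: face_fat_def fat_outer[OF bij])
  define z where "z = skip i (delete_perm i ?\<rho> x)"
  have "?q z = long_cycle (Suc n) (skip i x)"
  proof (cases "?\<rho> (skip i x) = Pt i")
    case True
    then have "z = ?\<rho> (Pt i)" by (simp add: z_def skip_delete_perm[OF inj\<rho>])
    then have "?q z = fat D (?\<rho> (skip i x))" by (simp add: face_fat_def True)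
    then show ?thesis by (simp add: fat_outer[OF bij])
  next
    case False
    moreover have "?\<rho> (skip i x) \<noteq> ?\<rho> (Pt i)" using inj\<rho> skip_neq by (metis injD)
    moreover have "z = ?\<rho> (skip i x)" using False by (simp add: z_def skip_delete_perm[OF inj\<rho>])
    ultimately have "?q z = fat D (?\<rho> (skip i x))" by (simp add: face_fat_def)
    then show ?thesis by (simp add: fat_outer[OF bij])
  qed
  then have "skip i (delete_perm i ?q (delete_perm i ?\<rho> x)) = skip i (long_cycle n x)"
    by (simp add: skip_delete_perm[OF injq] skip_long_cycle[OF i] q_i flip: z_def)
  then have "fat (face (Suc n) i D) (delete_perm i ?\<rho> x) = long_cycle n x"
    by (metis face_def diagram.sel(1) renumber_skip)
  then show "outer n (face (Suc n) i D) x = delete_perm i ?\<rho> x"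
    using inj_delete_perm[OF injq, of i] by (simp add: outer_def face_def inv_f_eq)
qed

lemma skip_points: "i \<le> Suc n \<Longrightarrow> skip i ` points n 0 = points (Suc n) 0 - {Pt i}"
proof
  assume i: "i \<le> Suc n"
  show "points (Suc n) 0 - {Pt i} \<subseteq> skip i ` points n 0"
  proof
    fix x assume x: "x \<in> points (Suc n) 0 - {Pt i}"
    then have "x = skip i (renumber i x)" by (simp add: skip_renumber)
    moreover have "renumber i x \<in> points n 0" using x i
      by (auto simp: points_def leaves_def image_iff split: if_splits)
    ultimately show "x \<in> skip i ` points n 0" by blast
  qed
qed (auto simp: points_def leaves_def split: if_splits)

lemma orbit_eq_iff:
  assumes "permutation p"
  shows "orbit p x = orbit p y \<longleftrightarrow> x \<in> orbit p y"
  using assms by (metis cyclic_on_orbit' orbit_cyclic_eq3 permutation_self_in_orbit)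

text \<open>
  Every cycle except \<open>(i)\<close> is the cycle of a point other than \<open>i\<close>, survives deletion, and
  is recovered from the surviving points.
\<close>

lemma outer_cycles_face:
  assumes fat: "fat D permutes points (Suc n) 0" and i: "i \<le> Suc n"
  shows "bij_betw (delete_cycle i) (outer_cycles (Suc n) D - {{Pt i}}) (outer_cycles n (face (Suc
    n) i D))"
proof -
  let ?\<rho> = "outer (Suc n) D"
  have perm: "?\<rho> permutes points (Suc n) 0" by (rule outer_permutes[OF fat])
  then have permn: "permutation ?\<rho>" using finite_points permutation_permutes by blast
  have self: "y \<in> orbit ?\<rho> y" for y by (rule permutation_self_in_orbit[OF permn])
  have cyc: "outer_cycles (Suc n) D - {{Pt i}} = orbit ?\<rho> ` (points (Suc n) 0 - {Pt i})"
  proof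
    show "outer_cycles (Suc n) D - {{Pt i}} \<subseteq> orbit ?\<rho> ` (points (Suc n) 0 - {Pt i})"
    proof
      fix c assume c: "c \<in> outer_cycles (Suc n) D - {{Pt i}}"
      then obtain y where y: "y \<in> points (Suc n) 0" "c = orbit ?\<rho> y" by (auto simp: perm_cycles_def)
      show "c \<in> orbit ?\<rho> ` (points (Suc n) 0 - {Pt i})"
      proof (cases "y = Pt i")
        case True
        then have "?\<rho> y \<noteq> Pt i" using c y orbit_eq_singleton_iff[of ?\<rho> y] by auto
        moreover have "c = orbit ?\<rho> (?\<rho> y)" by (simp add: y permutation_orbit_step[OF permn])
        ultimately show ?thesis using y permutes_in_image[OF perm] by blast
      qed (use y in blast)
    qed
    show "orbit ?\<rho> ` (points (Suc n) 0 - {Pt i}) \<subseteq> outer_cycles (Suc n) D - {{Pt i}}"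
      using self by (fastforce simp: perm_cycles_def)
  qed
  have "delete_cycle i ` (outer_cycles (Suc n) D - {{Pt i}})
      = outer_cycles n (face (Suc n) i D)"
    unfolding cyc skip_points[OF i, symmetric] outer_face[OF permutes_bij[OF fat] i]
    by (simp add: perm_cycles_def image_image orbit_delete_perm[OF permutes_inj[OF perm]])
  moreover have "inj_on (delete_cycle i) (outer_cycles (Suc n) D - {{Pt i}})"
  proof (rule inj_onI)
    fix c c' assume c: "c \<in> outer_cycles (Suc n) D - {{Pt i}}"
      "c' \<in> outer_cycles (Suc n) D - {{Pt i}}"
      and eq: "delete_cycle i c = delete_cycle i c'"
    obtain y y' where y: "y \<noteq> Pt i" "c = orbit ?\<rho> y" "c' = orbit ?\<rho> y'" using c cyc by auto
    have "c - {Pt i} = c' - {Pt i}"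
      using eq inj_on_image_eq_iff[OF inj_on_renumber, of "c - {Pt i}" i "c' - {Pt i}"]
        unfolding delete_cycle_def by blast
    then have "y \<in> orbit ?\<rho> y'" using self y by blast
    then show "c = c'" by (simp add: y orbit_eq_iff[OF permn])
  qed
  ultimately show ?thesis by (simp add: bij_betw_def)
qed

section \<open>Ghost surfaces of a face\<close>

text \<open>
  A ghost surface of a face is recognized by the points in its cycles, which change less than the
  cycles themselves.
\<close>

definition support :: "surface \<Rightarrow> point set" where
  "support S = \<Union> (scycles S)"

lemma support_delete_surface:
  "support (delete_surface i S) = renumber i ` (support S - {Pt i})"
  by (auto simp: support_def delete_surface_def delete_cycle_def)

lemma support_disjoint:
  assumes D: "sullivan_diagram n m D" and "S \<in> ghosts D" "T \<in> ghosts D" "S \<noteq> T"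
  shows "support S \<inter> support T = {}"
proof -
  have part: "partition_on (perm_cycles (fat D) (points n m)) (scycles ` ghosts D)"
    and inj: "inj_on scycles (ghosts D)" and fat: "fat D permutes points n m"
    using D by (auto simp: sullivan_diagram_def)
  have permn: "permutation (fat D)" using fat finite_points permutation_permutes by blast
  have "C \<inter> C' = {}" if C: "C \<in> scycles S" "C' \<in> scycles T" for C C'
  proof (rule ccontr)
    assume "C \<inter> C' \<noteq> {}"
    moreover have "C \<in> perm_cycles (fat D) (points n m)" "C' \<in> perm_cycles (fat D) (points n m)"
      using partition_onD1[OF part] C assms by auto
    ultimately have "C = C'"
      unfolding perm_cycles_def using orbit_eq_iff[OF permn] by (auto simp: disjoint_iff) metis+
    moreover have "scycles S \<inter> scycles T = {}"
      using partition_onD2[OF part] inj assms by (meson disjointD imageI inj_onD)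
    ultimately show False using C by blast
  qed
  then show ?thesis by (auto simp: support_def)
qed

lemma support_nonempty:
  assumes D: "sullivan_diagram n m D" and S: "S \<in> ghosts D"
  shows "support S \<noteq> {}"
proof -
  have part: "partition_on (perm_cycles (fat D) (points n m)) (scycles ` ghosts D)"
    using D by (auto simp: sullivan_diagram_def)
  obtain C where C: "C \<in> scycles S" using partition_onD3[OF part] S by fastforce
  then have "C \<in> perm_cycles (fat D) (points n m)" using partition_onD1[OF part] S by auto
  then have "C \<noteq> {}" by (auto simp: perm_cycles_def orbit_nonempty)
  then show ?thesis using C by (auto simp: support_def)
qed

text \<open>
  Composing with the transposition \<open>(i a)\<close> only merges or splits the cycles of \<open>i\<close> and \<open>a\<close>,
  so their union is invariant.
\<close>

lemma face_fat_orbit_subset: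
  assumes permn: "permutation (fat D)" and a: "a = outer n D (Pt i)" and x: "x \<in> {Pt i, a}"
  shows "orbit (face_fat n i D) x \<subseteq> orbit (fat D) (Pt i) \<union> orbit (fat D) a"
proof
  let ?U = "orbit (fat D) (Pt i) \<union> orbit (fat D) a"
  have self: "Pt i \<in> ?U" "a \<in> ?U" by (simp_all add: permutation_self_in_orbit[OF permn])
  have closed: "face_fat n i D y \<in> ?U" if "y \<in> ?U" for y
  proof -
    have "transpose (Pt i) a y \<in> ?U" using that self by (auto simp: transpose_def)
    then show ?thesis by (auto simp: face_fat_def a intro: orbit.step)
  qed
  fix y assume "y \<in> orbit (face_fat n i D) x"
  then show "y \<in> ?U"
    by induction (use self x closed in blast)+
qed

text \<open>
  A common description of the four cases, sufficient for controlling supports.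
\<close>

lemma face_surface_scycles:
  fixes n i D
  defines "Si \<equiv> surface_of D (Pt i)" and "Sa \<equiv> surface_of D (outer n D (Pt i))"
  shows "scycles (face_surface n i D S) = scycles S \<or>
    S \<in> {Si, Sa} \<and>
    (\<exists>c. scycles (face_surface n i D S) = insert (orbit (face_fat n i D) (Pt i)) c \<and>
         c \<subseteq> insert (orbit (face_fat n i D) (outer n D (Pt i))) (scycles Si \<union> scycles Sa))"
proof -
  \<comment> \<open>Once its constituents are named, the construction is a mere case distinction.\<close>
  define x where "x = Pt i"
  define a where "a = outer n D x"
  define Ci Ca where "Ci = orbit (fat D) x" and "Ca = orbit (fat D) a"
  define Oi Oa where "Oi = orbit (face_fat n i D) x" and "Oa = orbit (face_fat n i D) a"
  define R where "R = face_surface n i D S"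
  have "scycles R = scycles S \<or>
    S \<in> {Si, Sa} \<and> (\<exists>c. scycles R = insert Oi c \<and> c \<subseteq> insert Oa (scycles Si \<union> scycles Sa))"
    using R_def[unfolded face_surface_def Let_def, folded x_def, folded a_def Si_def[folded x_def]
      Sa_def[folded x_def, folded a_def], folded Ci_def Ca_def Oi_def Oa_def]
    by (cases "a = x"; cases "Ci = Ca"; cases "Si = Sa"; cases "S = Si"; cases "S = Sa";
        simp; blast)
  then show ?thesis unfolding R_def Oi_def Oa_def a_def x_def .
qed

lemma face_surface_support:
  assumes D: "sullivan_diagram n m D" and i: "i \<le> n" and S: "S \<in> ghosts D"
  defines "Si \<equiv> surface_of D (Pt i)" and "Sa \<equiv> surface_of D (outer n D (Pt i))"
  shows "support (face_surface n i D S) \<noteq> {}"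
    and "S \<in> {Si, Sa} \<Longrightarrow> support (face_surface n i D S) \<subseteq> support Si \<union> support Sa"
    and "S \<notin> {Si, Sa} \<Longrightarrow> face_surface n i D S = S"
proof -
  define a where "a = outer n D (Pt i)"
  have fat: "fat D permutes points n m" using D by (simp add: sullivan_diagram_def)
  then have permn: "permutation (fat D)" using finite_points permutation_permutes by blast
  have iP: "Pt i \<in> points n m" using i by (simp add: points_def)
  then have aP: "a \<in> points n m" unfolding a_def
    by (simp add: permutes_in_image[OF outer_permutes[OF fat]])
  have Ca: "orbit (fat D) (Pt i) \<subseteq> support Si" "orbit (fat D) a \<subseteq> support Sa"
    using surface_of_mem[OF D iP] surface_of_mem[OF D aP]
      by (auto simp: support_def Si_def Sa_def a_def)
  have orb: "orbit (face_fat n i D) (Pt i) \<subseteq> support Si \<union> support Sa"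
     "orbit (face_fat n i D) a \<subseteq> support Si \<union> support Sa"
    using face_fat_orbit_subset[OF permn a_def, of "Pt i"]
      face_fat_orbit_subset[OF permn a_def, of a] Ca by auto
  have ne: "orbit (face_fat n i D) (Pt i) \<noteq> {}" by (rule orbit_nonempty)
  let ?q = "face_fat n i D" and ?S' = "face_surface n i D S"
  note sc = face_surface_scycles[of n i D S, folded Si_def Sa_def, folded a_def]
  show "support ?S' \<noteq> {}"
    using sc
  proof
    assume "scycles ?S' = scycles S"
    then show ?thesis using support_nonempty[OF D S] by (simp add: support_def)
  next
    assume "S \<in> {Si, Sa} \<and> (\<exists>c. scycles ?S' = insert (orbit ?q (Pt i)) c \<and>
      c \<subseteq> insert (orbit ?q a) (scycles Si \<union> scycles Sa))"
    then show ?thesis using ne by (auto simp: support_def)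
  qed
  show "support ?S' \<subseteq> support Si \<union> support Sa" if "S \<in> {Si, Sa}"
  proof -
    have "scycles S \<subseteq> scycles Si \<union> scycles Sa" using that by blast
    then have "scycles ?S' \<subseteq> {orbit ?q (Pt i), orbit ?q a} \<union> (scycles Si \<union> scycles Sa)"
      using sc by blast
    then have "support ?S' \<subseteq> orbit ?q (Pt i) \<union> orbit ?q a \<union> (support Si \<union> support Sa)"
      unfolding support_def by blast
    then show ?thesis using orb by blast
  qed
  show "face_surface n i D S = S" if "S \<notin> {Si, Sa}"
    using that unfolding face_surface_def Let_def Si_def Sa_def
    by (simp only: insert_iff empty_iff de_Morgan_disj simp_thms if_False if_cancel)
qed

text \<open>
  Unless each of two distinct ghost surfaces contains \<open>i\<close> or \<open>a\<close>, the surfaces that they become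
  before the deletion of \<open>i\<close> still have disjoint supports. If the deletion made these surfaces
  equal, the supports would agree away from \<open>i\<close>; being non-empty and disjoint, they cannot both be
  contained in \<open>{i}\<close>.
\<close>

lemma face_ghost_eq_imp:
  assumes D: "sullivan_diagram n m D" and i: "i \<le> n" and S: "S \<in> ghosts D" and T: "T \<in> ghosts D"
    and eq: "face_ghost n i D S = face_ghost n i D T"
  shows "S = T \<or> {S, T} \<subseteq> {surface_of D (Pt i), surface_of D (outer n D (Pt i))}"
proof (rule ccontr)
  define Si Sa where "Si = surface_of D (Pt i)" and "Sa = surface_of D (outer n D (Pt i))"
  let ?s = "\<lambda>S. support (face_surface n i D S)"
  note supp = face_surface_support[OF D i, folded Si_def Sa_def]
  have fat: "fat D permutes points n m" using D by (simp add: sullivan_diagram_def)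
  have iP: "Pt i \<in> points n m" using i by (simp add: points_def)
  have aP: "outer n D (Pt i) \<in> points n m" using iP
    by (simp add: permutes_in_image[OF outer_permutes[OF fat]])
  have G: "Si \<in> ghosts D" "Sa \<in> ghosts D"
    using surface_of_mem(1)[OF D iP] surface_of_mem(1)[OF D aP] by (simp_all add: Si_def Sa_def)
  assume "\<not> (S = T \<or> {S, T} \<subseteq> {surface_of D (Pt i), surface_of D (outer n D (Pt i))})"
  then have ST: "S \<noteq> T" "S \<notin> {Si, Sa} \<or> T \<notin> {Si, Sa}" by (auto simp: Si_def Sa_def)
  have disj: "?s S \<inter> ?s T = {}" if "S \<in> ghosts D" "T \<in> ghosts D" "S \<noteq> T" "S \<notin> {Si, Sa}" for S T
  proof (cases "T \<in> {Si, Sa}")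
    case True
    then show ?thesis
      using supp(2)[OF that(2) True] supp(3)[OF that(1,4)] that(4)
        support_disjoint[OF D that(1) G(1)] support_disjoint[OF D that(1) G(2)] by auto
  next
    case False
    then show ?thesis using supp(3)[OF that(1,4)] supp(3)[OF that(2) False] support_disjoint[OF D
      that(1-3)] by simp
  qed
  have "renumber i ` (?s S - {Pt i}) = renumber i ` (?s T - {Pt i})"
    using arg_cong[OF eq, of support] by (simp add: face_ghost_def support_delete_surface)
  then have "?s S - {Pt i} = ?s T - {Pt i}"
    using inj_on_image_eq_iff[OF inj_on_renumber, of "?s S - {Pt i}" i "?s T - {Pt i}"] by blast
  moreover have "?s S \<inter> ?s T = {}" using disj[OF S T] disj[OF T S] ST by blast
  ultimately show False using supp(1)[OF S] supp(1)[OF T] by blast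
qed

lemma face_ghost_merge:
  assumes "surface_of D (Pt i) \<noteq> surface_of D (outer n D (Pt i))"
  shows "face_ghost n i D (surface_of D (Pt i))
    = face_ghost n i D (surface_of D (outer n D (Pt i)))"
proof -
  have "orbit (fat D) (Pt i) \<noteq> orbit (fat D) (outer n D (Pt i))" 
    using assms by (auto simp: surface_of_def)
  then show ?thesis using assms by (auto simp: face_ghost_def face_surface_def Let_def)
qed

text \<open>
  Merging occurs precisely when the surfaces of \<open>i\<close> and \<open>a\<close> are distinct, since this forces their
  cycles and the points themselves to be distinct.
\<close>

lemma spunct_face_ghost:
  fixes n i D
  defines "Si \<equiv> surface_of D (Pt i)" and "Sa \<equiv> surface_of D (outer n D (Pt i))"
  shows "spunct (face_ghost n i D S) =
    (if Si \<noteq> Sa \<and> S \<in> {Si, Sa} then spunct Si + spunct Sa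
     else spunct S + (if outer n D (Pt i) = Pt i \<and> S = Si then 1 else 0))"
proof -
  \<comment> \<open>Once its constituents are named, the construction is a mere case distinction.\<close>
  define x where "x = Pt i"
  define a where "a = outer n D x"
  define Ci Ca where "Ci = orbit (fat D) x" and "Ca = orbit (fat D) a"
  define Oi Oa where "Oi = orbit (face_fat n i D) x" and "Oa = orbit (face_fat n i D) a"
  define R where "R = face_surface n i D S"
  have eqs: "Ci = Ca \<Longrightarrow> Si = Sa" "a = x \<Longrightarrow> Si = Sa"
    by (auto simp: Ci_def Ca_def Si_def Sa_def surface_of_def x_def a_def)
  have "spunct R = (if Si \<noteq> Sa \<and> S \<in> {Si, Sa} then spunct Si + spunct Sa
     else spunct S + (if a = x \<and> S = Si then 1 else 0))"
    using R_def[unfolded face_surface_def Let_def, folded x_def, folded a_def Si_def[folded x_def]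
      Sa_def[folded x_def, folded a_def], folded Ci_def Ca_def Oi_def Oa_def] eqs
    by (cases "a = x"; cases "Ci = Ca"; cases "Si = Sa"; cases "S = Si"; cases "S = Sa"; simp)
  then show ?thesis
    by (simp only: R_def a_def x_def face_ghost_def o_apply delete_surface_def surface.sel)
qed

section \<open>Faces of enumerated diagrams\<close>

lemma underlying_face_enum [simp]: "underlying (face_enum m n i E) = face n i (underlying E)"
  by (simp add: face_enum_def Let_def)

text \<open>
  The ghost surface, before passing to the face, from which a label of the face comes. Factoring
  \<open>\<beta>\<^sub>2\<close> of the face through it separates the label of the cycle \<open>(i)\<close>, which turns into a puncture,
  from the effect of the face on ghost surfaces.
\<close>

definition follow_label :: "nat \<Rightarrow> nat \<Rightarrow> enum_diagram \<Rightarrow> nat \<Rightarrow> surface" where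
  "follow_label n i E l =
     (let D = underlying E in
      if outer n D (Pt i) = Pt i \<and> l = enum_cycles E {Pt i} then surface_of D (Pt i)
      else enum_ghosts E l)"

context
  fixes n m i :: nat and E :: enum_diagram
  assumes E: "E \<in> puncture_enumerations m (Suc n)"
    and D: "sullivan_diagram (Suc n) 0 (underlying E)"
    and i: "i \<le> Suc n"
begin

lemma enum_face_permutes: "fat (underlying E) permutes points (Suc n) 0"
  using D by (simp add: sullivan_diagram_def)

lemma fixed_point_outer_cycle:
  "{Pt i} \<in> outer_cycles (Suc n) (underlying E) \<longleftrightarrow> outer (Suc n) (underlying E) (Pt i) = Pt i"
proof
  let ?\<rho> = "outer (Suc n) (underlying E)"
  have permn: "permutation ?\<rho>"
    using outer_permutes[OF enum_face_permutes] finite_points permutation_permutes by blast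
  show "?\<rho> (Pt i) = Pt i" if "{Pt i} \<in> outer_cycles (Suc n) (underlying E)"
  proof -
    obtain y where y: "orbit ?\<rho> y = {Pt i}" using \<open>{Pt i} \<in> _\<close> by (auto simp: perm_cycles_def)
    then have "y = Pt i" using permutation_self_in_orbit[OF permn, of y] by simp
    then show ?thesis using y by (simp add: orbit_eq_singleton_iff)
  qed
  show "{Pt i} \<in> outer_cycles (Suc n) (underlying E)" if "?\<rho> (Pt i) = Pt i"
  proof -
    have "orbit ?\<rho> (Pt i) = {Pt i}" by (simp add: orbit_eq_singleton_iff that)
    moreover have "Pt i \<in> points (Suc n) 0" using i by (simp add: points_def)
    ultimately show ?thesis unfolding perm_cycles_def by (metis imageI)
  qed
qed

lemma enum_cycles_face_enum:
  "enum_cycles (face_enum m (Suc n) i E) =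
     restrict (enum_cycles E \<circ> inv_into (outer_cycles (Suc n) (underlying E) - {{Pt i}})
       (delete_cycle i))
       (outer_cycles n (face (Suc n) i (underlying E)))"
  by (simp add: face_enum_def Let_def outer_face[OF permutes_bij[OF enum_face_permutes] i])

lemma enum_ghosts_face_enum:
  "enum_ghosts (face_enum m (Suc n) i E) =
     restrict (face_ghost (Suc n) i (underlying E) \<circ> follow_label (Suc n) i E)
       (ghost_labels m n (face_enum m (Suc n) i E))"
  unfolding ghost_labels_def underlying_face_enum enum_cycles_face_enum
  by (auto simp: face_enum_def Let_def follow_label_def fun_eq_iff restrict_def
      outer_face[OF permutes_bij[OF enum_face_permutes] i])

lemma image_enum_cycles_face_enum:
  "enum_cycles (face_enum m (Suc n) i E) ` outer_cycles n (face (Suc n) i (underlying E))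
     = enum_cycles E ` (outer_cycles (Suc n) (underlying E) - {{Pt i}})"
proof -
  have "enum_cycles (face_enum m (Suc n) i E) ` outer_cycles n (face (Suc n) i (underlying E))
     = enum_cycles E ` inv_into (outer_cycles (Suc n) (underlying E) - {{Pt i}}) (delete_cycle i) `
         outer_cycles n (face (Suc n) i (underlying E))"
    by (simp add: enum_cycles_face_enum image_image)
  then show ?thesis
    using bij_betw_imp_surj_on[OF bij_betw_inv_into[OF outer_cycles_face[OF enum_face_permutes
      i]]] by simp
qed

lemma ghost_labels_face_enum:
  "ghost_labels m n (face_enum m (Suc n) i E) =
     ghost_labels m (Suc n) E \<union>
     (if outer (Suc n) (underlying E) (Pt i) = Pt i then {enum_cycles E {Pt i}} else {})"
proof (cases "outer (Suc n) (underlying E) (Pt i) = Pt i")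
  case True
  then have mem: "{Pt i} \<in> outer_cycles (Suc n) (underlying E)"
    by (simp add: fixed_point_outer_cycle)
  then have "enum_cycles E ` (outer_cycles (Suc n) (underlying E) - {{Pt i}}) =
      enum_cycles E ` outer_cycles (Suc n) (underlying E) - {enum_cycles E {Pt i}}"
    using E by (subst inj_on_image_set_diff[of _
      "outer_cycles (Suc n) (underlying E)"]) (auto simp: puncture_enumerations_def)
  moreover have "enum_cycles E {Pt i} \<in> {1..m}" using E mem
    by (auto simp: puncture_enumerations_def)
  ultimately show ?thesis
    using True by (auto simp: ghost_labels_def image_enum_cycles_face_enum)
next
  case False
  then have "outer_cycles (Suc n) (underlying E) - {{Pt i}} = outer_cycles (Suc n) (underlying E)"
    by (simp add: fixed_point_outer_cycle)
  then show ?thesis using False by (simp add: ghost_labels_def image_enum_cycles_face_enum)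
qed

lemma follow_label_mem:
  assumes "l \<in> ghost_labels m n (face_enum m (Suc n) i E)"
  shows "follow_label (Suc n) i E l \<in> ghosts (underlying E)"
proof -
  have "surface_of (underlying E) (Pt i) \<in> ghosts (underlying E)"
    using surface_of_mem(1)[OF D, of "Pt i"] i by (simp add: points_def)
  then show ?thesis
    using E assms by (auto simp: follow_label_def Let_def ghost_labels_face_enum
      puncture_enumerations_def split: if_splits)
qed

text \<open>
  The surface of \<open>i\<close> gains the label of the cycle \<open>(i)\<close>, if there is such a cycle.
\<close>

lemma card_follow_label:
  assumes "S \<in> ghosts (underlying E)"
  shows "card {l \<in> ghost_labels m n (face_enum m (Suc n) i E). follow_label (Suc n) i E l = S} =
     spunct S + (if outer (Suc n) (underlying E) (Pt i) = Pt i \<and> S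
       = surface_of (underlying E) (Pt i) then 1 else 0)"
proof -
  define F where "F = {l \<in> ghost_labels m (Suc n) E. enum_ghosts E l = S}"
  have F: "card F = spunct S" "finite F" using E assms
    by (auto simp: F_def puncture_enumerations_def ghost_labels_def)
  show ?thesis
  proof (cases "outer (Suc n) (underlying E) (Pt i) = Pt i")
    case True
    then have "enum_cycles E {Pt i} \<notin> ghost_labels m (Suc n) E"
      by (simp add: ghost_labels_def fixed_point_outer_cycle)
    then have "{l \<in> ghost_labels m n (face_enum m (Suc n) i E). follow_label (Suc n) i E l = S} =
        (if S = surface_of (underlying E) (Pt i) then insert (enum_cycles E {Pt i}) F else F)"
      and "enum_cycles E {Pt i} \<notin> F"
      using True by (auto simp: F_def ghost_labels_face_enum follow_label_def Let_def)
    then show ?thesis using F True by simp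
  next
    case False
    then show ?thesis using F by (simp add: F_def ghost_labels_face_enum follow_label_def Let_def)
  qed
qed

text \<open>
  The labels at a ghost surface of the face are the labels that come from the surfaces which it is
  made of: a single one, or the two that are merged. In either case the count is the number of
  punctures.
\<close>

lemma face_enum_in_puncture_enumerations: "face_enum m (Suc n) i E \<in> puncture_enumerations m n"
proof -
  let ?C = "outer_cycles (Suc n) (underlying E) - {{Pt i}}" and ?C' =
    "outer_cycles n (face (Suc n) i (underlying E))"
  let ?inv = "inv_into ?C (delete_cycle i)"
  let ?L = "ghost_labels m n (face_enum m (Suc n) i E)"
  let ?h = "face_ghost (Suc n) i (underlying E)" and ?follow = "follow_label (Suc n) i E"
  have inv: "bij_betw ?inv ?C' ?C"
    by (rule bij_betw_inv_into[OF outer_cycles_face[OF enum_face_permutes i]])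
  have injC: "inj_on (enum_cycles E) ?C"
    using E by (auto simp: puncture_enumerations_def intro: inj_on_subset)
  have "enum_cycles (face_enum m (Suc n) i E) \<in> ?C' \<rightarrow>\<^sub>E {1..m}"
    using E bij_betwE[OF inv] by (auto simp: enum_cycles_face_enum puncture_enumerations_def)
  moreover have "inj_on (enum_cycles (face_enum m (Suc n) i E)) ?C'"
    unfolding enum_cycles_face_enum inj_on_restrict_eq
    using inv injC by (intro comp_inj_on) (auto simp: bij_betw_def)
  moreover have "enum_ghosts (face_enum m (Suc n) i E) \<in> ?L \<rightarrow>\<^sub>E ghosts (face (Suc n) i (underlying
    E))"
    using follow_label_mem by (auto simp: enum_ghosts_face_enum face_def)
  moreover have "card {l \<in> ?L. enum_ghosts (face_enum m (Suc n) i E) l = ?h S} = spunct (?h S)"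
    if S: "S \<in> ghosts (underlying E)" for S
  proof -
    define Si Sa where "Si = surface_of (underlying E) (Pt i)"
      and "Sa = surface_of (underlying E) (outer (Suc n) (underlying E) (Pt i))"
    have fibre: "{l \<in> ?L. enum_ghosts (face_enum m (Suc n) i E) l = ?h S}
      = {l \<in> ?L. ?h (?follow l) = ?h S}"
      by (auto simp: enum_ghosts_face_enum)
    have finL: "finite ?L" by (simp add: ghost_labels_def)
    have iP: "Pt i \<in> points (Suc n) 0" using i by (simp add: points_def)
    have aP: "outer (Suc n) (underlying E) (Pt i) \<in> points (Suc n) 0"
      using iP by (simp add: permutes_in_image[OF outer_permutes[OF enum_face_permutes]])
    have G: "Si \<in> ghosts (underlying E)" "Sa \<in> ghosts (underlying E)"
      using surface_of_mem(1)[OF D iP] surface_of_mem(1)[OF D aP] by (simp_all add: Si_def Sa_def)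
    note inj = face_ghost_eq_imp[OF D i, folded Si_def Sa_def]
    note punct = spunct_face_ghost[of "Suc n" i "underlying E", folded Si_def Sa_def]
    note count = card_follow_label[folded Si_def]
    show ?thesis
    proof (cases "Si \<noteq> Sa \<and> S \<in> {Si, Sa}")
      case True
      then have not_fixed: "outer (Suc n) (underlying E) (Pt i) \<noteq> Pt i"
        by (auto simp: Si_def Sa_def)
      have "?h Si = ?h Sa" using face_ghost_merge[of "underlying E" i "Suc n"] True
        by (simp add: Si_def Sa_def)
      then have "{l \<in> ?L. ?h (?follow l) = ?h S} = {l \<in> ?L. ?follow l = Si} \<union> {l \<in> ?L. ?follow l
        = Sa}"
        using True inj[OF follow_label_mem S] by auto
      also have "card \<dots> = spunct Si + spunct Sa"
        using True finL not_fixed by (subst card_Un_disjoint)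
          (auto simp: count[OF G(1)] count[OF G(2)])
      finally show ?thesis using True by (simp add: fibre punct)
    next
      case False
      have "?h (?follow l) = ?h S \<longleftrightarrow> ?follow l = S" if "l \<in> ?L" for l
        using inj[OF follow_label_mem[OF that] S] False by auto
      then have "{l \<in> ?L. ?h (?follow l) = ?h S} = {l \<in> ?L. ?follow l = S}" by auto
      then show ?thesis using False by (simp only: fibre punct count[OF S] if_False)
    qed
  qed
  ultimately show ?thesis
    by (simp add: puncture_enumerations_def face_def)
qed

end

lemma follow_label_relabel:
  assumes \<sigma>: "\<sigma> permutes {1..m}" and E: "E \<in> puncture_enumerations m (Suc n)"
    and D: "sullivan_diagram (Suc n) 0 (underlying E)" and i: "i \<le> Suc n"
    and l: "l \<in> ghost_labels m n (face_enum m (Suc n) i E)"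
  shows "follow_label (Suc n) i (relabel m (Suc n) \<sigma> E) (\<sigma> l) = follow_label (Suc n) i E l"
proof (cases "outer (Suc n) (underlying E) (Pt i) = Pt i \<and> l = enum_cycles E {Pt i}")
  case True
  then have "{Pt i} \<in> outer_cycles (Suc n) (underlying E)"
    by (simp add: fixed_point_outer_cycle[OF E D i])
  then show ?thesis using True by (simp add: follow_label_def Let_def relabel_def)
next
  case False
  then have lab: "l \<in> ghost_labels m (Suc n) E"
    using l by (auto simp: ghost_labels_face_enum[OF E D i] split: if_splits)
  have "\<not> (outer (Suc n) (underlying E) (Pt i) = Pt i \<and>
      \<sigma> l = enum_cycles (relabel m (Suc n) \<sigma> E) {Pt i})"
    using False fixed_point_outer_cycle[OF E D i]
      by (auto simp: relabel_def inj_eq[OF permutes_inj[OF \<sigma>]])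
  then have "follow_label (Suc n) i (relabel m (Suc n) \<sigma> E) (\<sigma> l)
    = enum_ghosts (relabel m (Suc n) \<sigma> E) (\<sigma> l)"
    by (simp only: follow_label_def Let_def underlying_relabel if_False)
  also have "\<dots> = enum_ghosts E l" using lab by (simp add: relabel_def permutes_inverses[OF \<sigma>])
  also have "\<dots> = follow_label (Suc n) i E l" using False
    by (simp only: follow_label_def Let_def if_False)
  finally show ?thesis .
qed

lemma face_enum_relabel:
  assumes \<sigma>: "\<sigma> permutes {1..m}" and E: "E \<in> puncture_enumerations m (Suc n)"
    and D: "sullivan_diagram (Suc n) 0 (underlying E)" and i: "i \<le> Suc n"
  shows "face_enum m (Suc n) i (relabel m (Suc n) \<sigma> E) = relabel m n \<sigma> (face_enum m (Suc n) i E)"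
proof (rule enum_diagram.expand, intro conjI)
  let ?E' = "relabel m (Suc n) \<sigma> E"
  have E': "?E' \<in> puncture_enumerations m (Suc n)"
    by (rule relabel_in_puncture_enumerations[OF \<sigma> E])
  show "underlying (face_enum m (Suc n) i ?E')
    = underlying (relabel m n \<sigma> (face_enum m (Suc n) i E))" by simp
  show cycles: "enum_cycles (face_enum m (Suc n) i ?E')
    = enum_cycles (relabel m n \<sigma> (face_enum m (Suc n) i E))"
  proof -
    let ?C = "outer_cycles (Suc n) (underlying E) - {{Pt i}}"
    have "inv_into ?C (delete_cycle i) c \<in> outer_cycles (Suc n) (underlying E)"
      if "c \<in> outer_cycles n (face (Suc n) i (underlying E))" for c
      using bij_betwE[OF bij_betw_inv_into[OF outer_cycles_face[OF enum_face_permutes[OF E D i]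
        i]]] that by blast
    then show ?thesis
      by (auto simp: face_enum_def relabel_def Let_def fun_eq_iff restrict_def
          outer_face[OF permutes_bij[OF enum_face_permutes[OF E D i]] i])
  qed
  have labels: "ghost_labels m n (face_enum m (Suc n) i ?E')
    = \<sigma> ` ghost_labels m n (face_enum m (Suc n) i E)"
    unfolding ghost_labels_relabel[OF \<sigma>, symmetric] by (simp add: ghost_labels_def cycles)
  show "enum_ghosts (face_enum m (Suc n) i ?E')
    = enum_ghosts (relabel m n \<sigma> (face_enum m (Suc n) i E))"
  proof
    fix k
    let ?L = "ghost_labels m n (face_enum m (Suc n) i E)" and ?h =
      "face_ghost (Suc n) i (underlying E)"
    show "enum_ghosts (face_enum m (Suc n) i ?E') k
      = enum_ghosts (relabel m n \<sigma> (face_enum m (Suc n) i E)) k"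
    proof (cases "k \<in> \<sigma> ` ?L")
      case True
      then obtain l where l: "k = \<sigma> l" "l \<in> ?L" by blast
      have "enum_ghosts (face_enum m (Suc n) i ?E') k = ?h (follow_label (Suc n) i ?E' (\<sigma> l))"
        using l by (simp add: enum_ghosts_face_enum[of ?E', unfolded underlying_relabel, OF E' D
          i] labels)
      also have "\<dots> = ?h (follow_label (Suc n) i E l)"
        by (simp add: follow_label_relabel[OF \<sigma> E D i l(2)])
      also have "\<dots> = enum_ghosts (face_enum m (Suc n) i E) l"
        using l by (simp add: enum_ghosts_face_enum[OF E D i])
      also have "\<dots> = enum_ghosts (relabel m n \<sigma> (face_enum m (Suc n) i E)) k"
        using l by (simp add: relabel_def permutes_inverses[OF \<sigma>])
      finally show ?thesis .
    next
      case False
      then have "enum_ghosts (face_enum m (Suc n) i ?E') k = undefined"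
        by (simp add: enum_ghosts_face_enum[of ?E', unfolded underlying_relabel, OF E' D i] labels)
      also have "\<dots> = enum_ghosts (relabel m n \<sigma> (face_enum m (Suc n) i E)) k"
        using False by (simp add: relabel_def)
      finally show ?thesis .
    qed
  qed
qed

section \<open>The two transfers\<close>

lemma transfer_forgetting_punctures:
  "\<exists>tr. \<forall>n. tr n \<in> hom (H_unpar_unenum g m n) (H_unpar_enum g m n) \<and>
            (\<forall>x \<in> carrier (H_unpar_unenum g m n).
               forget_punctures_homology g m n (tr n x)
                 = x [^]\<^bsub>H_unpar_unenum g m n\<^esub> (fact m :: nat))"
proof -
  have card: "fact m = (fact (card {1..m}) :: nat)" by simp
  show ?thesis
    unfolding H_unpar_unenum_def H_unpar_enum_def forget_punctures_homology_def card
  proof (rule homology_transfer_of_symmetric_group_action[where act = "relabel m" and V =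
    "puncture_enumerations m"])
    fix n x assume "x \<in> unpar_unenum g m n"
    then show "\<exists>E\<in>puncture_enumerations m n. underlying E = x"
      using puncture_enumeration_exists by (simp add: unpar_unenum_def)
  next
    fix n i E assume "E \<in> unpar_enum g m (Suc n)" "i \<le> Suc n"
    then show "face_enum m (Suc n) i E \<in> puncture_enumerations m n"
      using face_enum_in_puncture_enumerations by (simp add: unpar_enum_iff unpar_unenum_def)
  next
    fix n i \<sigma> E assume "\<sigma> permutes {1..m}" "E \<in> unpar_enum g m (Suc n)" "i \<le> Suc n"
    then show "face_enum m (Suc n) i (relabel m (Suc n) \<sigma> E)
      = relabel m n \<sigma> (face_enum m (Suc n) i E)"
      using face_enum_relabel by (simp add: unpar_enum_iff unpar_unenum_def)
  qed (use puncture_enumerations_transitive in \<open>auto simp: unpar_enum_iff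
    relabel_in_puncture_enumerations relabel_comp\<close>)
qed

text \<open>
  The orbits are the generators of the unenumerated complex, so any diagram may serve as a candidate
  lift, and compatibility of the forgetful map with faces is equivariance once more.
\<close>

lemma transfer_forgetting_leaves:
  "\<exists>tr. \<forall>n. tr n \<in> hom (H_par_unenum g m n) (H_par_enum g m n) \<and>
            (\<forall>x \<in> carrier (H_par_unenum g m n).
               forget_leaves_homology g m n (tr n x) = x [^]\<^bsub>H_par_unenum g m n\<^esub> (fact m :: nat))"
proof -
  have "card (leaves m) = m" by (simp add: leaves_def card_image inj_on_def)
  then have card: "fact m = (fact (card (leaves m)) :: nat)" by simp
  have sullivan: "sullivan_diagram n m D" if "D \<in> par_enum g m n" for n D
    using that by (simp add: par_enum_def)
  show ?thesis
    unfolding H_par_unenum_def H_par_enum_def forget_leaves_homology_def card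
  proof (rule homology_transfer_of_symmetric_group_action[where act = "\<lambda>_. rename_leaves" and V =
    "\<lambda>_. UNIV"])
    show "finite (leaves m)" by (simp add: leaves_def)
  next
    fix n x assume "x \<in> par_unenum g m n"
    then show "\<exists>D\<in>UNIV. leaf_orbit m D = x" by (auto simp: par_unenum_def)
  next
    fix n D show "D \<in> par_enum g m n \<longleftrightarrow> D \<in> UNIV \<and> leaf_orbit m D \<in> par_unenum g m n"
    proof
      assume "D \<in> UNIV \<and> leaf_orbit m D \<in> par_unenum g m n"
      then obtain D0 where D0: "D0 \<in> par_enum g m n" "leaf_orbit m D0 = leaf_orbit m D"
        unfolding par_unenum_def by auto
      then obtain \<tau> where "\<tau> permutes leaves m" "D = rename_leaves \<tau> D0"
        by (auto simp: leaf_orbit_eq_iff)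
      then show "D \<in> par_enum g m n" using rename_leaves_par_enum D0(1) by simp
    qed (simp add: par_unenum_def)
  next
    fix \<tau> D assume "\<tau> permutes leaves m"
    then show "leaf_orbit m (rename_leaves \<tau> D) = leaf_orbit m D"
      using leaf_orbit_eq_iff[of m D] by metis
  next
    fix \<sigma> \<tau> D assume "\<sigma> permutes leaves m" "\<tau> permutes leaves m"
    then show "rename_leaves \<sigma> (rename_leaves \<tau> D) = rename_leaves (\<sigma> \<circ> \<tau>) D"
      by (rule rename_leaves_comp)
  next
    fix D D' assume "leaf_orbit m D = leaf_orbit m D'"
    then show "\<exists>\<tau>. \<tau> permutes leaves m \<and> D' = rename_leaves \<tau> D" by (simp add: leaf_orbit_eq_iff)
  next
    fix n i D assume D: "D \<in> par_enum g m (Suc n)" and i: "i \<le> Suc n"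
    note equivariant = face_rename_leaves[OF _ sullivan[OF D] i]
    show "leaf_orbit m (face (Suc n) i D) = face_orbit (Suc n) i (leaf_orbit m D)"
      by (auto simp: leaf_orbit_def face_orbit_def equivariant image_iff) (metis equivariant)
    fix \<tau> assume "\<tau> permutes leaves m"
    then show "face (Suc n) i (rename_leaves \<tau> D) = rename_leaves \<tau> (face (Suc n) i D)"
      by (rule equivariant)
  qed auto
qed

theorem proposition3:
  fixes g m :: nat
  assumes "m \<ge> 1"
  shows "(\<exists>tr. \<forall>n. tr n \<in> hom (H_par_unenum g m n) (H_par_enum g m n) \<and>
            (\<forall>x \<in> carrier (H_par_unenum g m n).
               forget_leaves_homology g m n (tr n x) = x [^]\<^bsub>H_par_unenum g m n\<^esub> (fact m :: nat)))
       \<and> (\<exists>tr. \<forall>n. tr n \<in> hom (H_unpar_unenum g m n) (H_unpar_enum g m n) \<and>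
            (\<forall>x \<in> carrier (H_unpar_unenum g m n).
               forget_punctures_homology g m n (tr n x) = x [^]\<^bsub>H_unpar_unenum g m n\<^esub> (fact m :: nat)))"
  using transfer_forgetting_leaves transfer_forgetting_punctures by (rule conjI)

end
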